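(* Suppose $(b_1,b_2,b_3)\neq(2,3,5)$, where the integers $0<b_1<b_2<b_3$ are pairwise relatively prime. Let $Y=\Sigma(b_1,b_2,b_3)$ be the Brieskorn sphere, with plumbing tree $\Gamma$ (the three-legged tree described in the context) having $s$ vertices and linking matrix $M$. Put $p=b_1b_2b_3$ and $$\alpha_1=p-b_1b_2-b_1b_3-b_2b_3,\quad \alpha_2=p+b_1b_2-b_1b_3-b_2b_3,$$ $$\alpha_3=p-b_1b_2+b_1b_3-b_2b_3,\quad \alpha_4=p+b_1b_2+b_1b_3-b_2b_3 .$$ For $i=1,2,3$ let $h_i$ be the absolute value of the determinant of the linking matrix of the graph obtained from $\Gamma$ by deleting the terminal vertex on the $i$-th leg, and let $$\xi=\frac14\left(\sum_{i=1}^3 h_i-3s-\operatorname{Tr}(M)-\frac{b_2b_3}{b_1}-\frac{b_1b_3}{b_2}-\frac{b_1b_2}{b_3}\right)\in\mathbb{Q}.$$ Then $$\widehat Z_0(Y;q)=q^{\Delta_0}\cdot\left[q^{-\frac{\alpha_1^2}{4p}}\left(\widetilde\Psi^{(\alpha_1)}_p(q)-\widetilde\Psi^{(\alpha_2)}_p(q)-\widetilde\Psi^{(\alpha_3)}_p(q)+\widetilde\Psi^{(\alpha_4)}_p(q)\right)\right],$$ where $$\Delta_0=\Delta_0(Y)=\xi+\frac{\alpha_1^2}{4p}.$$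
   Context: **Plumbing tree of a Brieskorn sphere.** $\Sigma(b_1,b_2,b_3)=\{(x,y,z)\in\mathbb{C}^3: x^{b_1}+y^{b_2}+z^{b_3}=0\}\cap S^5$; it is a negative definite plumbed 3-manifold and an integral homology sphere. Choose integers $b<0$ and $a_1,a_2,a_3>0$ with $b_1b_2b_3\,b+b_2b_3a_1+b_1b_3a_2+b_1b_2a_3=-1$ (the choice is not unique). Take the continued fraction decomposition $\frac{b_i}{a_i}=[k_{i,1},\dots,k_{i,s_i}]=k_{i,1}-\cfrac{1}{k_{i,2}-\cfrac{1}{\cdots-\cfrac1{k_{i,s_i}}}}$. Then $\Sigma(b_1,b_2,b_3)=Y(\Gamma)$, where $\Gamma$ is the weighted tree with a central vertex of weight $b$ and three legs attached to it, the $i$-th leg being a chain of vertices with weights $-k_{i,1},\dots,-k_{i,s_i}$, the vertex of weight $-k_{i,1}$ being adjacent to the central vertex. The vertex of weight $-k_{i,s_i}$ is the terminal vertex of the $i$-th leg. **General setting.** Let $\Gamma$ be a tree with vertices $v_1,\dots,v_s$ and integer weights $w_1,\dots,w_s$. Its linking matrix $M$ is the symmetric $s\times s$ matrix with $M_{ii}=w_i$, and for $i\ne j$, $M_{ij}=1$ if $v_i,v_j$ are adjacent and $M_{ij}=0$ otherwise. $Y(\Gamma)$ is the closed oriented 3-manifold bounding the 4-dimensional plumbing along $\Gamma$ of disk bundles over $S^2$ with Euler numbers $w_i$. Let $\sigma$ be the signature of $M$ (number of positive minus number of negative eigenvalues), $\pi$ the number of positive eigenvalues, and $\vec\delta=(\deg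 v_i)_i$. $\operatorname{Spin}^c$ structures on $Y(\Gamma)$ correspond to $(2\mathbb{Z}^s+\vec\delta)/2M\mathbb{Z}^s$; if $Y(\Gamma)$ is an integral homology sphere there is exactly one, denoted $0$. **$\widehat Z_a$.** For $a$ with representative $\vec a\in 2\mathbb{Z}^s+\vec\delta$, $$\widehat Z_a(Y;q)=(-1)^\pi q^{\frac{3\sigma-\operatorname{Tr}M}{4}}\ \mathrm{v.p.}\oint_{|z_1|=1}\!\!\cdots\oint_{|z_s|=1}\prod_{i=1}^s\Big(z_i-\frac1{z_i}\Big)^{2-\deg v_i}\ \sum_{\vec l\in 2M\mathbb{Z}^s+\vec a}q^{-\frac{(\vec l,M^{-1}\vec l)}{4}}\prod_{i=1}^s z_i^{l_i}\ \frac{dz_s}{2\pi i z_s}\cdots\frac{dz_1}{2\pi i z_1},$$ where $q$ is a formal variable, the integral is taken termwise in the sum over $\vec l$, and in each variable $\mathrm{v.p.}\oint_{|z|=1}=\frac12\left[\oint_{|z|=1-\epsilon}+\oint_{|z|=1+\epsilon}\right]$ for small $\epsilon>0$. **$\Delta_a$.** A reduced indexing set for $\widehat Z_a(Y;q)$ is a set $I\subseteq 2M\mathbb{Z}^s+\vec a$ such that $\widehat Z_a(Y;q)=\sum_{\vec\ell\in I}c_{\vec\ell}\,q^{\frac{3\sigma-\operatorname{Tr}M}{4}-\frac{(\vec\ell,M^{-1}\vec\ell)}{4}}$ with all $c_{\vec\ell}\in\mathbb{Q}\setminus\{0\}$ and with pairwise distinct exponents of $q$. Then $\Delta_a=\frac{3\sigma-\operatorname{Tr}M}{4}-\max_{\vec\ell\in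 I}\frac{(\vec\ell,M^{-1}\vec\ell)}{4}$ (independent of the choice of $I$). **False theta functions.** $\widetilde\Psi^{(a)}_p(q)=\sum_{n=0}^\infty\psi^{(a)}_{2p}(n)\,q^{\frac{n^2}{4p}}$, where $\psi^{(a)}_{2p}(n)=1$ if $n\equiv a \pmod{2p}$, $-1$ if $n\equiv -a\pmod{2p}$, and $0$ otherwise.
   Formalization: The formal statement assumes 1 < b_1 instead of 0 < b_1; for b_1 = 1 the claim fails, since α_4 = −α_1 and α_3 = −α_2 make the false theta combination vanish while Ẑ_0 of Y = S^3 is nonzero (e.g. (1,2,3)). *)

theory Defs
  imports
    "HOL-Complex_Analysis.Complex_Analysis"
    "HOL-Number_Theory.Cong"
    "Jordan_Normal_Form.Determinant"
    "Jordan_Normal_Form.Char_Poly"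
    "Jordan_Normal_Form.Gauss_Jordan_Elimination"
begin

text \<open>
  Vertices are \<open>0, \<dots>, nverts G - 1\<close>; an edge is an unordered pair \<open>{u, v}\<close>.
\<close>

datatype plumbing =
  Plumbing (nverts: nat) (weight: "nat \<Rightarrow> int") (edges: "nat set set")

definition vdeg :: "plumbing \<Rightarrow> nat \<Rightarrow> nat" where
  "vdeg G i = card {j. j < nverts G \<and> j \<noteq> i \<and> {i, j} \<in> edges G}"

definition linking_matrix :: "plumbing \<Rightarrow> int Matrix.mat" where
  "linking_matrix G = Matrix.mat (nverts G) (nverts G)
     (\<lambda>(i, j). if i = j then weight G i else if {i, j} \<in> edges G then 1 else 0)"

definition mat_trace :: "'a::comm_monoid_add Matrix.mat \<Rightarrow> 'a" where
  "mat_trace A = (\<Sum>i<dim_row A. A $$ (i, i))"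

text \<open>
  The vertices above \<open>v\<close> move down by one, so that the vertex set is again an initial segment.
\<close>

definition del_vertex :: "nat \<Rightarrow> plumbing \<Rightarrow> plumbing" where
  "del_vertex v G = Plumbing (nverts G - 1) (\<lambda>i. weight G (insert_index v i))
     {e. insert_index v ` e \<in> edges G}"


section \<open>The three-legged tree of a Brieskorn sphere\<close>

fun cfrac :: "int list \<Rightarrow> rat" where
  "cfrac [] = 0"
| "cfrac [k] = of_int k"
| "cfrac (k # k' # ks) = of_int k - 1 / cfrac (k' # ks)"

text \<open>
  A negative continued fraction is made unique by requiring every entry after the first to be at
  least \<open>2\<close>; the first entry is then the ceiling of \<open>x\<close> (and may be \<open>1\<close>, when \<open>0 < x \<le> 1\<close>).
\<close>

definition cfrac_of :: "int list \<Rightarrow> rat \<Rightarrow> bool" where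
  "cfrac_of ks x \<longleftrightarrow> ks \<noteq> [] \<and> (\<forall>k\<in>set (tl ks). 2 \<le> k) \<and> cfrac ks = x"

text \<open>
  A leg with \<open>n\<close> vertices \<open>u, \<dots>, u + n - 1\<close>, attached to the central vertex \<open>0\<close> at \<open>u\<close>.
\<close>

definition leg_edges :: "nat \<Rightarrow> nat \<Rightarrow> nat set set" where
  "leg_edges u n = {{0, u}} \<union> {{u + j, u + j + 1} |j. j + 1 < n}"

definition three_leg_tree :: "int \<Rightarrow> int list \<Rightarrow> int list \<Rightarrow> int list \<Rightarrow> plumbing" where
  "three_leg_tree b k1 k2 k3 =
     (let ws = b # map uminus (k1 @ k2 @ k3) in
      Plumbing (length ws) (\<lambda>i. ws ! i)
        (leg_edges 1 (length k1)
         \<union> leg_edges (1 + length k1) (length k2)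
         \<union> leg_edges (1 + length k1 + length k2) (length k3)))"


section \<open>Signature and the form given by the inverse matrix\<close>

text \<open>
  Eigenvalues are counted with algebraic multiplicity; for the symmetric matrices considered here
  all of them are real.
\<close>

definition num_pos_eigenvalues :: "int Matrix.mat \<Rightarrow> nat" where
  "num_pos_eigenvalues M = (let A = map_mat real_of_int M in
     \<Sum>x | eigenvalue A x \<and> 0 < x. Polynomial.order x (char_poly A))"

definition num_neg_eigenvalues :: "int Matrix.mat \<Rightarrow> nat" where
  "num_neg_eigenvalues M = (let A = map_mat real_of_int M in
     \<Sum>x | eigenvalue A x \<and> x < 0. Polynomial.order x (char_poly A))"

definition signature :: "int Matrix.mat \<Rightarrow> int" where
  "signature M = int (num_pos_eigenvalues M) - int (num_neg_eigenvalues M)"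

definition inv_form :: "int Matrix.mat \<Rightarrow> int Matrix.vec \<Rightarrow> rat" where
  "inv_form M l = (let l' = map_vec rat_of_int l in
     scalar_prod l' (the (mat_inverse (map_mat rat_of_int M)) *\<^sub>v l'))"


section \<open>Formal series in q with rational exponents\<close>

text \<open>
  A series is given by its coefficient function.  In \<open>qsum A c e\<close>, the formal sum of
  \<open>c x q\<^bsup>e x\<^esup>\<close> over \<open>x \<in> A\<close>, every exponent must be attained by only finitely many \<open>x \<in> A\<close>
  with \<open>c x \<noteq> 0\<close> (otherwise that coefficient is \<open>0\<close> by convention).
\<close>

type_synonym qseries = "rat \<Rightarrow> complex"

definition qsum :: "'x set \<Rightarrow> ('x \<Rightarrow> complex) \<Rightarrow> ('x \<Rightarrow> rat) \<Rightarrow> qseries" where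
  "qsum A c e = (\<lambda>r. \<Sum>x | x \<in> A \<and> c x \<noteq> 0 \<and> e x = r. c x)"

text \<open>Multiplication of a series by \<open>q\<^bsup>t\<^esup>\<close>.\<close>

definition qshift :: "rat \<Rightarrow> qseries \<Rightarrow> qseries" where
  "qshift t f = (\<lambda>r. f (r - t))"

definition false_theta_coeff :: "int \<Rightarrow> int \<Rightarrow> nat \<Rightarrow> int" where
  "false_theta_coeff p a n =
     (if [int n = a] (mod 2 * p) then 1 else if [int n = - a] (mod 2 * p) then -1 else 0)"

definition false_theta :: "int \<Rightarrow> int \<Rightarrow> qseries" where
  "false_theta p a =
     qsum UNIV (\<lambda>n. of_int (false_theta_coeff p a n)) (\<lambda>n. of_nat (n\<^sup>2) / of_int (4 * p))"


section \<open>The series Z-hat\<close>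

text \<open>
  For the rational functions integrated below, the average is constant for small \<open>\<epsilon> > 0\<close>.
\<close>

definition vp_integral :: "(complex \<Rightarrow> complex) \<Rightarrow> complex" where
  "vp_integral f = Lim (at_right 0) (\<lambda>\<epsilon>::real.
     (contour_integral (circlepath 0 (1 - \<epsilon>)) f + contour_integral (circlepath 0 (1 + \<epsilon>)) f) / 2)"

text \<open>
  The iterated integral of \<open>F [z\<^sub>1, \<dots>, z\<^sub>s]\<close> against the forms \<open>dz\<^sub>i / (2 \<pi> \<i> z\<^sub>i)\<close>;
  the variable \<open>z\<^sub>s\<close> is integrated first.
\<close>

primrec iterated_vp_integral :: "nat \<Rightarrow> (complex list \<Rightarrow> complex) \<Rightarrow> complex" where
  "iterated_vp_integral 0 F = F []"
| "iterated_vp_integral (Suc s) F =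
     vp_integral (\<lambda>z. iterated_vp_integral s (\<lambda>zs. F (z # zs)) / (2 * of_real pi * \<i> * z))"

definition degree_vec :: "plumbing \<Rightarrow> int Matrix.vec" where
  "degree_vec G = Matrix.vec (nverts G) (\<lambda>i. int (vdeg G i))"

definition spinc_reps :: "plumbing \<Rightarrow> int Matrix.vec set" where
  "spinc_reps G = {2 \<cdot>\<^sub>v x + degree_vec G |x. x \<in> carrier_vec (nverts G)}"

definition spinc_class :: "plumbing \<Rightarrow> int Matrix.vec \<Rightarrow> int Matrix.vec set" where
  "spinc_class G a =
     {2 \<cdot>\<^sub>v (linking_matrix G *\<^sub>v x) + a |x. x \<in> carrier_vec (nverts G)}"

definition Zhat_prefactor_exponent :: "plumbing \<Rightarrow> rat" where
  "Zhat_prefactor_exponent G =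
     of_int (3 * signature (linking_matrix G) - mat_trace (linking_matrix G)) / 4"

definition Zhat_exponent :: "plumbing \<Rightarrow> int Matrix.vec \<Rightarrow> rat" where
  "Zhat_exponent G l = Zhat_prefactor_exponent G - inv_form (linking_matrix G) l / 4"

definition Zhat_integral :: "plumbing \<Rightarrow> int Matrix.vec \<Rightarrow> complex" where
  "Zhat_integral G l = iterated_vp_integral (nverts G) (\<lambda>z.
     (\<Prod>i<nverts G. (z ! i - 1 / z ! i) powi (2 - int (vdeg G i)))
     * (\<Prod>i<nverts G. (z ! i) powi (vec_index l i)))"

definition Zhat :: "plumbing \<Rightarrow> int Matrix.vec \<Rightarrow> qseries" where
  "Zhat G a = (\<lambda>r. (-1) ^ num_pos_eigenvalues (linking_matrix G)
     * qsum (spinc_class G a) (Zhat_integral G) (Zhat_exponent G) r)"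

definition reduced_indexing_set :: "plumbing \<Rightarrow> int Matrix.vec \<Rightarrow> int Matrix.vec set \<Rightarrow> bool" where
  "reduced_indexing_set G a I \<longleftrightarrow>
     I \<subseteq> spinc_class G a \<and> inj_on (Zhat_exponent G) I \<and>
     (\<exists>c. (\<forall>l\<in>I. c l \<in> \<rat> - {0}) \<and> Zhat G a = qsum I c (Zhat_exponent G))"

text \<open>
  The set \<open>I\<close> is usually infinite, so the maximum is stated explicitly instead of with \<open>Max\<close>;
  \<open>THE\<close> expresses that the value does not depend on the choice of \<open>I\<close>.
\<close>

definition Delta :: "plumbing \<Rightarrow> int Matrix.vec \<Rightarrow> rat" where
  "Delta G a = (THE d. \<exists>I m. reduced_indexing_set G a I \<and>
     m \<in> (\<lambda>l. inv_form (linking_matrix G) l / 4) ` I \<and>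
     (\<forall>l\<in>I. inv_form (linking_matrix G) l / 4 \<le> m) \<and>
     d = Zhat_prefactor_exponent G - m)"

end

theory Submission
  imports Defs
begin

text \<open>
  The linking matrix \<open>M\<close> of the three-legged tree is unimodular and negative definite, so the
  \<open>Spin\<^sup>c\<close> class is the whole coset \<open>2 \<int>\<^sup>s + \<delta>\<close>, the sign \<open>(-1)\<^sup>\<pi>\<close> is \<open>1\<close> and the signature is \<open>- s\<close>.
  Both properties come from reading the tree from the ends of its legs towards the centre.
  Along a leg, the rows of \<open>M x = 0\<close> make every entry a continuant times the entry at the terminal
  vertex, and the continued fraction of \<open>b\<^sub>i / a\<^sub>i\<close> has continuants \<open>b\<^sub>i\<close> and \<open>a\<^sub>i\<close>; the Seifert
  equation then excludes kernel vectors modulo every integer (lemma \<open>kernel_mod_trivial\<close>).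
  Completing squares in the same direction bounds the quadratic form by
  \<open>(b + a\<^sub>1 / b\<^sub>1 + a\<^sub>2 / b\<^sub>2 + a\<^sub>3 / b\<^sub>3) x\<^sub>0\<^sup>2 = - x\<^sub>0\<^sup>2 / p\<close> (lemma \<open>M_form_nonpos\<close>).

  The integral attached to a vector \<open>l\<close> is a product of one-variable principal values.  A vertex of
  degree \<open>2\<close> forces \<open>l\<^sub>i = 0\<close>, a terminal vertex forces \<open>l\<^sub>i = e\<^sub>i\<close> with \<open>e\<^sub>i = \<plusminus>1\<close> and contributes
  \<open>- e\<^sub>i\<close>, and the centre with \<open>l\<^sub>0 = n\<close> odd contributes \<open>sgn n / 2\<close>.  Only the entries of
  \<open>M\<inverse>\<close> at the centre and the terminal vertices therefore matter.  Up to sign these are \<open>p\<close>, \<open>p / b\<^sub>i\<close>,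
  \<open>p / (b\<^sub>i b\<^sub>j)\<close> and, on the diagonal, the minors \<open>h\<^sub>i\<close>; completing one more square gives the exponent
  \<open>\<xi> + N\<^sup>2 / (4 p)\<close> with \<open>N = p n + e\<^sub>1 b\<^sub>2 b\<^sub>3 + e\<^sub>2 b\<^sub>1 b\<^sub>3 + e\<^sub>3 b\<^sub>1 b\<^sub>2\<close>
  (lemmas \<open>Zhat_exponent_end_vec\<close> and \<open>Zhat_eq_sum\<close>).

  The symmetry \<open>(n, e) \<mapsto> (- n, - e)\<close> preserves coefficients and exponents and cancels the factor
  \<open>1 / 2\<close>, leaving \<open>N \<ge> 0\<close>.  For fixed signs \<open>e\<close> the values \<open>N \<ge> 0\<close> are the
  nonnegative members of one residue class modulo \<open>2 p\<close>, and the eight classes are \<open>\<plusminus> \<alpha>\<^sub>1, \<dots>, \<plusminus> \<alpha>\<^sub>4\<close>: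
  this is the combination of false theta functions.  It uses \<open>1 / b\<^sub>1 + 1 / b\<^sub>2 + 1 / b\<^sub>3 < 1\<close>, which
  is where \<open>(2, 3, 5)\<close> is excluded; the same inequality makes \<open>\<alpha>\<^sub>1\<close> the least value of \<open>N\<close>, attained
  once, and hence \<open>\<Delta>\<^sub>0 = \<xi> + \<alpha>\<^sub>1\<^sup>2 / (4 p)\<close>.
\<close>

section \<open>Continued fractions and legs\<close>

text \<open>The determinant of the tridiagonal matrix of a leg, up to sign.\<close>

fun continuant :: "int list \<Rightarrow> int" where
  "continuant [] = 1"
| "continuant [k] = k"
| "continuant (k # k' # ks) = k * continuant (k' # ks) - continuant ks"

text \<open>Entries at least \<open>2\<close> make continuants grow towards the head, so no denominator vanishes.\<close>

lemma continuant_gt_tail: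
  assumes "\<forall>k\<in>set ks. 2 \<le> k" "ks \<noteq> []"
  shows "continuant ks > continuant (tl ks) \<and> continuant (tl ks) \<ge> 1"
  using assms
proof (induction ks rule: continuant.induct)
  case (3 k k' ks)
  have ih: "continuant (k' # ks) > continuant ks" "continuant ks \<ge> 1"
    using 3 by auto
  have "2 * continuant (k' # ks) \<le> k * continuant (k' # ks)"
    using 3 ih by (intro mult_right_mono) auto
  then have "continuant (k # k' # ks) > continuant (k' # ks)"
    unfolding continuant.simps using ih by linarith
  then show ?case using ih by (simp del: continuant.simps)
qed auto

lemma coprime_continuant_tail:
  assumes "ks \<noteq> []"
  shows "coprime (continuant ks) (continuant (tl ks))"
  using assms
proof (induction ks rule: continuant.induct)
  case (3 k k' ks)
  have "coprime (continuant (k' # ks)) (continuant ks)"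
    using 3 by simp
  then have "coprime (- continuant ks + k * continuant (k' # ks)) (continuant (k' # ks))"
    by (metis coprime_commute coprime_minus_right_iff gcd_add_mult coprime_iff_gcd_eq_1 add.commute gcd.commute)
  then show ?case by (simp add: algebra_simps)
qed auto

lemma cfrac_eq_continuants:
  assumes "\<forall>k\<in>set (tl ks). 2 \<le> k" "ks \<noteq> []"
  shows "cfrac ks = of_int (continuant ks) / of_int (continuant (tl ks))"
  using assms
proof (induction ks rule: continuant.induct)
  case (3 k k' ks)
  have pos: "continuant (k' # ks) > 0"
    using continuant_gt_tail[of "k' # ks"] "3.prems" by auto
  have "cfrac (k' # ks) = of_int (continuant (k' # ks)) / of_int (continuant ks)"
    using 3 by simp
  then show ?case using pos by (simp add: field_simps)
qed auto

text \<open>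
  A fraction in lowest terms determines its numerator and denominator, so the continuants of a leg
  recover the Seifert invariants.
\<close>

lemma cfrac_of_continuants:
  assumes "cfrac_of ks (of_int n / of_int d)" "coprime n d" "0 < n" "0 < d"
  shows "continuant ks = n" "continuant (tl ks) = d"
proof -
  have ks: "ks \<noteq> []" "\<forall>k\<in>set (tl ks). 2 \<le> k" "cfrac ks = of_int n / of_int d"
    using assms(1) by (auto simp: cfrac_of_def)
  have tpos: "continuant (tl ks) > 0"
    using continuant_gt_tail[of "tl ks"] ks(2) by (cases "tl ks = []") auto
  have "(of_int (continuant ks) / of_int (continuant (tl ks)) :: rat) = of_int n / of_int d"
    using cfrac_eq_continuants[OF ks(2,1)] ks(3) by simp
  then have "(of_int (continuant ks * d) :: rat) = of_int (n * continuant (tl ks))"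
    using tpos assms(4) by (simp add: field_simps)
  then have eq: "continuant ks * d = n * continuant (tl ks)"
    by (simp only: of_int_eq_iff)
  have cop: "coprime (continuant ks) (continuant (tl ks))"
    by (rule coprime_continuant_tail[OF ks(1)])
  have "d dvd continuant (tl ks)"
    by (metis eq assms(2) coprime_commute coprime_dvd_mult_right_iff dvd_triv_right)
  moreover have "continuant (tl ks) dvd d"
    by (metis eq cop coprime_commute coprime_dvd_mult_right_iff dvd_triv_right)
  ultimately show d: "continuant (tl ks) = d"
    using tpos assms(4) by (simp add: zdvd_antisym_nonneg)
  show "continuant ks = n" using eq d assms(4) by simp
qed

text \<open>
  The rows of the linking matrix along a leg: \<open>y\<close> is the value at the vertex to which the leg is
  attached, and \<open>x 0, \<dots>, x (length ks - 1)\<close> are the values along the leg.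
\<close>

definition leg_row :: "int list \<Rightarrow> 'a::comm_ring_1 \<Rightarrow> (nat \<Rightarrow> 'a) \<Rightarrow> nat \<Rightarrow> 'a" where
  "leg_row ks y x j = (if j = 0 then y else x (j - 1)) - of_int (ks ! j) * x j
     + (if Suc j < length ks then x (Suc j) else 0)"

lemma leg_row_Cons_0:
  "leg_row (k # ks) y x 0 = y - of_int k * x 0 + (if ks = [] then 0 else x 1)"
  by (auto simp: leg_row_def)

lemma leg_row_Cons_Suc:
  "leg_row (k # ks) y x (Suc j) = leg_row ks (x 0) (\<lambda>j. x (Suc j)) j"
  by (cases j) (auto simp: leg_row_def)

text \<open>
  Reading the rows from the terminal vertex towards the centre, every value on the leg is a multiple
  of the terminal one, and the multipliers are the continuants of the tails.  The modulus \<open>d = 0\<close>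
  gives equalities.
\<close>

lemma leg_kernel_cong:
  fixes x :: "nat \<Rightarrow> int"
  assumes "ks \<noteq> []" "\<And>j. j < length ks \<Longrightarrow> [leg_row ks y x j = 0] (mod d)"
  shows "[y = continuant ks * x (length ks - 1)] (mod d)
    \<and> [x 0 = continuant (tl ks) * x (length ks - 1)] (mod d)
    \<and> (\<forall>j<length ks. \<exists>c. [x j = c * x (length ks - 1)] (mod d))"
  using assms
proof (induction ks arbitrary: x y rule: continuant.induct)
  case (2 k)
  have "[y - k * x 0 = 0] (mod d)" using "2.prems"(2)[of 0] by (simp add: leg_row_def)
  moreover have "\<exists>c. [x 0 = c * x 0] (mod d)" by (rule exI[of _ 1]) simp
  ultimately show ?case by (simp add: cong_iff_dvd_diff)
next
  case (3 k k' ks)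
  let ?x = "\<lambda>j. x (Suc j)" and ?t = "x (Suc (length ks))"
  have rows: "[leg_row (k' # ks) (x 0) ?x j = 0] (mod d)" if "j < length (k' # ks)" for j
    using "3.prems"(2)[of "Suc j"] that by (simp add: leg_row_Cons_Suc)
  have ih: "[x 0 = continuant (k' # ks) * ?t] (mod d)" "[x 1 = continuant ks * ?t] (mod d)"
    "\<And>j. j < length (k' # ks) \<Longrightarrow> \<exists>c. [x (Suc j) = c * ?t] (mod d)"
    using "3.IH"(1)[of "x 0" ?x] rows by auto
  have "[y - k * x 0 + x 1 = 0] (mod d)"
    using "3.prems"(2)[of 0] by (simp add: leg_row_Cons_0)
  then have "d dvd y - k * x 0 + x 1" "d dvd x 0 - continuant (k' # ks) * ?t"
    "d dvd x 1 - continuant ks * ?t"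
    using ih(1,2) by (simp_all add: cong_iff_dvd_diff)
  then have "d dvd (y - k * x 0 + x 1) + k * (x 0 - continuant (k' # ks) * ?t)
      - (x 1 - continuant ks * ?t)"
    by (metis dvd_add dvd_diff dvd_mult)
  then have "[y = continuant (k # k' # ks) * ?t] (mod d)"
    by (simp add: cong_iff_dvd_diff algebra_simps)
  moreover have "\<exists>c. [x j = c * ?t] (mod d)" if "j < length (k # k' # ks)" for j
    using ih(1) ih(3)[of "j - 1"] that by (cases j) auto
  ultimately show ?case using ih(1) by simp
qed auto

text \<open>
  Completing squares from the terminal vertex towards the centre: with
  \<open>T = continuant ks / continuant (tl ks)\<close> the quadratic form of the leg is a sum of negative squares
  plus \<open>2 y x\<^sub>0 - T x\<^sub>0\<^sup>2\<close>, and the latter is at most \<open>y\<^sup>2 / T\<close>.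
\<close>

lemma leg_form_le:
  fixes x :: "nat \<Rightarrow> real"
  assumes "ks \<noteq> []" "\<forall>k\<in>set (tl ks). 2 \<le> k" "continuant ks > 0"
  shows "y * x 0 + (\<Sum>j<length ks. x j * leg_row ks y x j)
    \<le> y\<^sup>2 * of_int (continuant (tl ks)) / of_int (continuant ks)"
  using assms
proof (induction ks arbitrary: x y rule: continuant.induct)
  case (2 k)
  have "0 \<le> (y - of_int k * x 0)\<^sup>2" by simp
  then have "(2 * y * x 0 - of_int k * (x 0)\<^sup>2) * of_int k \<le> y\<^sup>2"
    by (simp add: power2_eq_square algebra_simps)
  then have "2 * y * x 0 - of_int k * (x 0)\<^sup>2 \<le> y\<^sup>2 / of_int k"
    using "2.prems" by (simp add: pos_le_divide_eq)
  then show ?case by (simp add: leg_row_def power2_eq_square algebra_simps)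
next
  case (3 k k' ks)
  let ?x = "\<lambda>j. x (Suc j)"
  let ?n = "real_of_int (continuant (k' # ks))" and ?d = "real_of_int (continuant ks)"
  let ?N = "real_of_int (continuant (k # k' # ks))"
  have npos: "?n > 0" using continuant_gt_tail[of "k' # ks"] "3.prems" by auto
  have Npos: "?N > 0" using "3.prems" by linarith
  have N: "?N = of_int k * ?n - ?d" by simp
  have ih: "x 0 * x 1 + (\<Sum>j<length (k' # ks). x (Suc j) * leg_row (k' # ks) (x 0) ?x j)
      \<le> (x 0)\<^sup>2 * ?d / ?n"
    using "3.IH"(1)[of "x 0" ?x] "3.prems" npos by auto
  have "y * x 0 + (\<Sum>j<length (k # k' # ks). x j * leg_row (k # k' # ks) y x j)
      = 2 * y * x 0 - of_int k * (x 0)\<^sup>2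
        + (x 0 * x 1 + (\<Sum>j<length (k' # ks). x (Suc j) * leg_row (k' # ks) (x 0) ?x j))"
    by (simp only: length_Cons[of k] sum.lessThan_Suc_shift leg_row_Cons_Suc leg_row_Cons_0)
      (simp add: power2_eq_square algebra_simps)
  also have "\<dots> \<le> 2 * y * x 0 - of_int k * (x 0)\<^sup>2 + (x 0)\<^sup>2 * ?d / ?n"
    using ih by simp
  also have "\<dots> = 2 * y * x 0 - (x 0)\<^sup>2 * ?N / ?n"
    using npos by (simp only: N) (simp add: field_simps)
  also have "\<dots> \<le> y\<^sup>2 * ?n / ?N"
  proof -
    have "0 \<le> (y * ?n - x 0 * ?N)\<^sup>2 / (?n * ?N)" using npos Npos by simp
    also have "\<dots> = y\<^sup>2 * ?n / ?N - (2 * y * x 0 - (x 0)\<^sup>2 * ?N / ?n)"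
      using npos Npos by (simp add: field_simps power2_eq_square del: continuant.simps)
    finally show ?thesis by simp
  qed
  finally show ?case by simp
qed auto

section \<open>Principal value integrals\<close>

text \<open>
  The one-variable integrals below depend on the circle only through the side of \<open>\<bar>z\<bar> = 1\<close> on which it
  lies, so the principal value is the limit of a constant.
\<close>

definition has_vp_integral :: "(complex \<Rightarrow> complex) \<Rightarrow> complex \<Rightarrow> bool" where
  "has_vp_integral f L \<longleftrightarrow> (\<exists>I J. L = (I + J) / 2 \<and>
     (\<forall>r. 0 < r \<and> r < 1 \<longrightarrow> (f has_contour_integral I) (circlepath 0 r)) \<and>
     (\<forall>r. 1 < r \<longrightarrow> (f has_contour_integral J) (circlepath 0 r)))"

lemma vp_integral_eqI:
  assumes "has_vp_integral f L"
  shows "vp_integral f = L"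
proof -
  obtain I J where IJ: "L = (I + J) / 2"
    "\<And>r. 0 < r \<Longrightarrow> r < 1 \<Longrightarrow> (f has_contour_integral I) (circlepath 0 r)"
    "\<And>r. 1 < r \<Longrightarrow> (f has_contour_integral J) (circlepath 0 r)"
    using assms unfolding has_vp_integral_def by blast
  have "eventually (\<lambda>\<epsilon>::real. (contour_integral (circlepath 0 (1 - \<epsilon>)) f
      + contour_integral (circlepath 0 (1 + \<epsilon>)) f) / 2 = L) (at_right 0)"
  proof (rule eventually_at_rightI[of 0 1])
    fix e :: real assume e: "e \<in> {0<..<1}"
    have "contour_integral (circlepath 0 (1 - e)) f = I"
      using e IJ(2)[of "1 - e"] by (intro contour_integral_unique) auto
    moreover have "contour_integral (circlepath 0 (1 + e)) f = J"
      using e IJ(3)[of "1 + e"] by (intro contour_integral_unique) auto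
    ultimately show "(contour_integral (circlepath 0 (1 - e)) f
      + contour_integral (circlepath 0 (1 + e)) f) / 2 = L"
      by (simp only: IJ(1))
  qed simp
  then show ?thesis
    unfolding vp_integral_def by (intro tendsto_Lim tendsto_eventually) simp_all
qed

lemma has_vp_integral_cmult:
  assumes "has_vp_integral f L"
  shows "has_vp_integral (\<lambda>z. c * f z) (c * L)"
proof -
  obtain I J where IJ: "L = (I + J) / 2"
    "\<And>r. 0 < r \<Longrightarrow> r < 1 \<Longrightarrow> (f has_contour_integral I) (circlepath 0 r)"
    "\<And>r. 1 < r \<Longrightarrow> (f has_contour_integral J) (circlepath 0 r)"
    using assms unfolding has_vp_integral_def by blast
  have "c * L = (c * I + c * J) / 2" by (simp add: IJ(1) distrib_left)
  then show ?thesis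
    unfolding has_vp_integral_def using IJ(2,3) has_contour_integral_lmul by blast
qed

text \<open>
  The scalar \<open>C\<close> carries the factors of the outer variables, which are constants for the inner
  integrals.
\<close>

lemma iterated_vp_integral_prod:
  assumes "\<And>i. i < s \<Longrightarrow> has_vp_integral (\<lambda>z. f i z / (2 * of_real pi * \<i> * z)) (L i)"
  shows "iterated_vp_integral s (\<lambda>zs. C * (\<Prod>i<s. f i (zs ! i))) = C * (\<Prod>i<s. L i)"
  using assms
proof (induction s arbitrary: f L C)
  case (Suc s)
  have "iterated_vp_integral s (\<lambda>zs. C * (\<Prod>i<Suc s. f i ((z # zs) ! i)))
      = C * f 0 z * (\<Prod>i<s. L (Suc i))" for z
  proof -
    have "iterated_vp_integral s (\<lambda>zs. (C * f 0 z) * (\<Prod>i<s. f (Suc i) (zs ! i)))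
      = (C * f 0 z) * (\<Prod>i<s. L (Suc i))"
      by (rule Suc.IH) (use Suc.prems in auto)
    then show ?thesis by (simp add: prod.lessThan_Suc_shift mult.assoc del: prod.lessThan_Suc)
  qed
  then have "iterated_vp_integral (Suc s) (\<lambda>zs. C * (\<Prod>i<Suc s. f i (zs ! i)))
      = vp_integral (\<lambda>z. (C * (\<Prod>i<s. L (Suc i))) * (f 0 z / (2 * of_real pi * \<i> * z)))"
    by (simp del: prod.lessThan_Suc add: mult_ac)
  also have "\<dots> = (C * (\<Prod>i<s. L (Suc i))) * L 0"
    by (intro vp_integral_eqI has_vp_integral_cmult Suc.prems) simp
  finally show ?case
    by (simp add: prod.lessThan_Suc_shift mult_ac del: prod.lessThan_Suc)
qed simp

lemma has_contour_integral_powi_circlepath: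
  assumes r: "0 < r"
  shows "((\<lambda>z. z powi n) has_contour_integral (if n = -1 then 2 * of_real pi * \<i> else 0))
    (circlepath 0 r)"
proof (cases "n = -1")
  case True
  have "((\<lambda>z. 1 / (z - 0)) has_contour_integral 2 * of_real pi * \<i> * 1) (circlepath 0 r)"
    by (rule Cauchy_integral_circlepath_simple) (use r in auto)
  then show ?thesis using True
    by (auto simp: divide_inverse power_int_minus elim!: has_contour_integral_eq)
next
  case False
  have "((\<lambda>z. z powi n) has_contour_integral
      (\<lambda>z. z powi (n + 1) / of_int (n + 1)) (pathfinish (circlepath 0 r))
      - (\<lambda>z. z powi (n + 1) / of_int (n + 1)) (pathstart (circlepath 0 r))) (circlepath 0 r)"
  proof (rule contour_integral_primitive[of "- {0}"])
    fix z :: complex assume z: "z \<in> - {0}"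
    have nz: "(of_int n + 1 :: complex) \<noteq> 0"
      using False by (metis add_eq_0_iff2 of_int_1 of_int_add of_int_eq_0_iff)
    show "((\<lambda>z. z powi (n + 1) / of_int (n + 1)) has_field_derivative z powi n) (at z within - {0})"
      using z nz by (auto intro!: derivative_eq_intros)
  qed (use r in auto)
  then show ?thesis using False by simp
qed

text \<open>
  The moments of the kernel \<open>1 / (z\<^sup>2 - 1)\<close> over odd powers.  Consecutive moments differ by the
  integral of a monomial, so they are constant on the positive and on the negative side and jump by
  \<open>2 \<pi> \<i>\<close> between the two; on the side where \<open>r\<^sup>l\<close> decays they tend to, hence are equal to, \<open>0\<close>.
\<close>

lemma has_contour_integral_odd_moment:
  fixes r :: real and l :: int
  assumes r: "0 < r" "r \<noteq> 1" and l: "odd l"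
  shows "((\<lambda>z. z powi l / (z\<^sup>2 - 1)) has_contour_integral
    (2 * of_real pi * \<i> * ((if 0 < l then 1 else 0) - (if r < 1 then 1 else 0)))) (circlepath 0 r)"
proof -
  define I where "I l = contour_integral (circlepath 0 r) (\<lambda>z. z powi l / (z\<^sup>2 - 1))" for l :: int
  have nz: "z \<noteq> 0" "z\<^sup>2 - 1 \<noteq> 0" if "norm z = r" for z :: complex
  proof -
    show "z \<noteq> 0" using that r by auto
    have "norm (z\<^sup>2) = r\<^sup>2" using that by (simp add: norm_power)
    moreover have "r\<^sup>2 \<noteq> 1" using r by (auto simp: power2_eq_1_iff)
    ultimately show "z\<^sup>2 - 1 \<noteq> 0" by auto
  qed
  have int: "((\<lambda>z. z powi l / (z\<^sup>2 - 1)) has_contour_integral I l) (circlepath 0 r)" for l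
    unfolding I_def
    by (intro has_contour_integral_integral contour_integrable_continuous_circlepath
        continuous_intros) (use nz r in auto)
  have step: "I (l + 2) = I l + (if l = -1 then 2 * of_real pi * \<i> else 0)" for l
  proof -
    have "((\<lambda>z. z powi l / (z\<^sup>2 - 1) + z powi l) has_contour_integral
        I l + (if l = -1 then 2 * of_real pi * \<i> else 0)) (circlepath 0 r)"
      by (intro has_contour_integral_add int has_contour_integral_powi_circlepath r)
    then have "((\<lambda>z. z powi (l + 2) / (z\<^sup>2 - 1)) has_contour_integral
        I l + (if l = -1 then 2 * of_real pi * \<i> else 0)) (circlepath 0 r)"
    proof (rule has_contour_integral_eq)
      fix z assume "z \<in> path_image (circlepath 0 r)"
      then have "norm z = r" using r by auto
      from nz[OF this] show "z powi l / (z\<^sup>2 - 1) + z powi l = z powi (l + 2) / (z\<^sup>2 - 1)"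
        by (simp add: power_int_add field_simps)
    qed
    then show ?thesis using int has_contour_integral_unique by blast
  qed
  have bound: "norm (I l) \<le> (2 * pi * r / \<bar>r\<^sup>2 - 1\<bar>) * r powi l" for l
  proof -
    have "norm (I l) \<le> (r powi l / \<bar>r\<^sup>2 - 1\<bar>) * (2 * pi * r)"
    proof (rule has_contour_integral_bound_circlepath[OF int])
      fix z :: complex assume z: "norm (z - 0) = r"
      have "\<bar>r\<^sup>2 - 1\<bar> \<le> norm (z\<^sup>2 - 1)"
        using norm_triangle_ineq3[of "z\<^sup>2" 1] z by (simp add: norm_power)
      moreover have "\<bar>r\<^sup>2 - 1\<bar> > 0" using r by (auto simp: power2_eq_1_iff)
      ultimately show "norm (z powi l / (z\<^sup>2 - 1)) \<le> r powi l / \<bar>r\<^sup>2 - 1\<bar>"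
        using z r by (auto simp: norm_divide norm_power_int intro!: divide_left_mono mult_pos_pos)
    qed (use r in auto)
    then show ?thesis by (simp add: mult_ac)
  qed
  have A: "I (2 * int n + 1) = I 1" for n
    by (induction n) (use step[of "2 * int n + 1" for n] in \<open>auto simp: algebra_simps\<close>)
  have B: "I (- 1 - 2 * int n) = I (-1)" for n
  proof (induction n)
    case (Suc n)
    then show ?case using step[of "- 1 - 2 * int (Suc n)"] by (simp add: algebra_simps)
  qed simp
  have jump: "I 1 = I (-1) + 2 * of_real pi * \<i>" using step[of "-1"] by simp
  have vanish: "w = 0" if q: "0 \<le> q" "q < 1" and le: "\<And>n. norm w \<le> C * q ^ n"
    for w :: complex and C q :: real
  proof -
    have "(\<lambda>n. C * q ^ n) \<longlonglongrightarrow> C * 0"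
      by (intro tendsto_intros LIMSEQ_realpow_zero q)
    then have "norm w \<le> C * 0"
      by (rule LIMSEQ_le_const) (use le in auto)
    then show ?thesis by simp
  qed
  let ?C = "2 * pi * r / \<bar>r\<^sup>2 - 1\<bar>"
  have one: "I 1 = (if r < 1 then 0 else 2 * of_real pi * \<i>)"
  proof (cases "r < 1")
    case True
    have "I 1 = 0"
    proof (rule vanish[of "r\<^sup>2" _ "?C * r"])
      show "r\<^sup>2 < 1" using True r by (simp add: power_less_one_iff)
      fix n
      have "r powi (2 * int n + 1) = (r\<^sup>2) ^ n * r"
        using r by (simp add: power_int_add power_int_mult)
      then show "norm (I 1) \<le> (?C * r) * (r\<^sup>2) ^ n"
        using bound[of "2 * int n + 1"] unfolding A by (simp add: mult_ac)
    qed simp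
    then show ?thesis using True by simp
  next
    case False
    have "I (-1) = 0"
    proof (rule vanish[of "inverse (r\<^sup>2)" _ "?C * inverse r"])
      have "1 < r\<^sup>2" using False r by (simp add: one_less_power)
      then show "inverse (r\<^sup>2) < 1" by (simp add: inverse_less_1_iff)
      fix n
      have "r powi (- 1 - 2 * int n) = inverse (r\<^sup>2) ^ n * inverse r"
        using r by (simp add: power_int_diff power_int_mult power_int_minus field_simps
            power_inverse)
          (simp only: mult.commute power_mult[symmetric])
      then show "norm (I (-1)) \<le> (?C * inverse r) * inverse (r\<^sup>2) ^ n"
        using bound[of "- 1 - 2 * int n"] unfolding B by (simp add: mult_ac)
    qed simp
    then show ?thesis using False jump by simp
  qed
  have "I l = 2 * of_real pi * \<i> * ((if 0 < l then 1 else 0) - (if r < 1 then 1 else 0))"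
  proof -
    obtain m where m: "l = 2 * m + 1" using l by (elim oddE)
    show ?thesis
    proof (cases "0 \<le> m")
      case True
      then show ?thesis using A[of "nat m"] one m by simp
    next
      case False
      then have "l = - 1 - 2 * int (nat (- m - 1))" using m by simp
      then have "I l = I (-1)" using B by metis
      moreover have "I (-1) = I 1 - 2 * of_real pi * \<i>" using jump by simp
      ultimately show ?thesis using False one m by simp
    qed
  qed
  then show ?thesis using int[of l] by simp
qed

text \<open>
  The one-variable integrals at vertices of degree \<open>2\<close>, \<open>1\<close> and \<open>3\<close>.  They are the averages of the
  coefficients of \<open>z\<^bsup>-l\<^esup>\<close> in the expansions of \<open>(z - 1 / z)\<^bsup>2 - deg\<^esup>\<close> at \<open>0\<close> and at \<open>\<infinity>\<close>.
\<close>

definition vertex_integrand :: "nat \<Rightarrow> int \<Rightarrow> complex \<Rightarrow> complex" where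
  "vertex_integrand d l z =
     (z - 1 / z) powi (2 - int d) * z powi l / (2 * of_real pi * \<i> * z)"

lemma has_vp_integral_vertex_2:
  "has_vp_integral (vertex_integrand 2 l) (if l = 0 then 1 else 0)"
proof -
  let ?L = "if l = 0 then 1 else 0 :: complex"
  have "(vertex_integrand 2 l has_contour_integral ?L) (circlepath 0 r)" if r: "0 < r" for r
  proof -
    have "((\<lambda>z. (1 / (2 * of_real pi * \<i>)) * z powi (l - 1)) has_contour_integral
      (1 / (2 * of_real pi * \<i>)) * (if l - 1 = -1 then 2 * of_real pi * \<i> else 0)) (circlepath 0 r)"
      by (intro has_contour_integral_lmul has_contour_integral_powi_circlepath r)
    then have "((\<lambda>z. (1 / (2 * of_real pi * \<i>)) * z powi (l - 1)) has_contour_integral ?L)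
        (circlepath 0 r)"
      by (simp split: if_splits)
    then show ?thesis
    proof (rule has_contour_integral_eq)
      fix z assume "z \<in> path_image (circlepath 0 r)"
      then have "z \<noteq> 0" using r by auto
      then show "(1 / (2 * of_real pi * \<i>)) * z powi (l - 1) = vertex_integrand 2 l z"
        by (simp add: vertex_integrand_def power_int_diff)
    qed
  qed
  then show ?thesis
    unfolding has_vp_integral_def by (intro exI[of _ ?L]) auto
qed

lemma has_vp_integral_vertex_1:
  "has_vp_integral (vertex_integrand 1 l) ((if l = -1 then 1 else 0) - (if l = 1 then 1 else 0))"
proof -
  let ?L = "(if l = -1 then 1 else 0) - (if l = 1 then 1 else 0) :: complex"
  have "(vertex_integrand 1 l has_contour_integral ?L) (circlepath 0 r)" if r: "0 < r" for r
  proof -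
    have "((\<lambda>z. (1 / (2 * of_real pi * \<i>)) * (z powi l - z powi (l - 2))) has_contour_integral
      (1 / (2 * of_real pi * \<i>)) * ((if l = -1 then 2 * of_real pi * \<i> else 0)
        - (if l - 2 = -1 then 2 * of_real pi * \<i> else 0))) (circlepath 0 r)"
      by (intro has_contour_integral_lmul has_contour_integral_diff
          has_contour_integral_powi_circlepath r)
    then have "((\<lambda>z. (1 / (2 * of_real pi * \<i>)) * (z powi l - z powi (l - 2)))
        has_contour_integral ?L) (circlepath 0 r)"
      by (simp split: if_splits)
    then show ?thesis
    proof (rule has_contour_integral_eq)
      fix z assume "z \<in> path_image (circlepath 0 r)"
      then have "z \<noteq> 0" using r by auto
      then show "(1 / (2 * of_real pi * \<i>)) * (z powi l - z powi (l - 2)) = vertex_integrand 1 l z"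
        by (simp add: vertex_integrand_def power_int_diff field_simps power2_eq_square)
    qed
  qed
  then show ?thesis
    unfolding has_vp_integral_def by (intro exI[of _ ?L]) auto
qed

lemma has_vp_integral_vertex_3:
  assumes "odd l"
  shows "has_vp_integral (vertex_integrand 3 l) (of_int (sgn l) / 2)"
proof -
  let ?L = "\<lambda>r::real. (if 0 < l then 1 else 0) - (if r < 1 then 1 else 0) :: complex"
  have *: "(vertex_integrand 3 l has_contour_integral ?L r) (circlepath 0 r)"
    if r: "0 < r" "r \<noteq> 1" for r
  proof -
    have "((\<lambda>z. (1 / (2 * of_real pi * \<i>)) * (z powi l / (z\<^sup>2 - 1))) has_contour_integral
      (1 / (2 * of_real pi * \<i>)) * (2 * of_real pi * \<i> * ?L r)) (circlepath 0 r)"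
      by (intro has_contour_integral_lmul has_contour_integral_odd_moment r assms)
    then have "((\<lambda>z. (1 / (2 * of_real pi * \<i>)) * (z powi l / (z\<^sup>2 - 1)))
        has_contour_integral ?L r) (circlepath 0 r)"
      by simp
    then show ?thesis
    proof (rule has_contour_integral_eq)
      fix z assume "z \<in> path_image (circlepath 0 r)"
      then have z: "z \<noteq> 0" "norm z = r" using r by auto
      have "(z - 1 / z) * z = z\<^sup>2 - 1" using z by (simp add: field_simps power2_eq_square)
      moreover have "vertex_integrand 3 l z
          = (1 / (2 * of_real pi * \<i>)) * (z powi l / ((z - 1 / z) * z))"
      proof -
        have "inverse w * u / (c * z) = 1 / c * (u / (w * z))" for w u c :: complex
          by (simp add: divide_inverse)
        moreover have "(z - 1 / z) powi (2 - int 3) = inverse (z - 1 / z)"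
          by (simp add: power_int_minus)
        ultimately show ?thesis unfolding vertex_integrand_def by metis
      qed
      ultimately show "(1 / (2 * of_real pi * \<i>)) * (z powi l / (z\<^sup>2 - 1)) = vertex_integrand 3 l z"
        by simp
    qed
  qed
  let ?J = "if 0 < l then 1 else 0 :: complex"
  have "of_int (sgn l) / 2 = ((?J - 1) + ?J) / 2"
    using assms by (auto simp: sgn_if)
  moreover have "(vertex_integrand 3 l has_contour_integral ?J - 1) (circlepath 0 r)"
    if "0 < r \<and> r < 1" for r
  proof -
    have "?L r = ?J - 1" using that by simp
    moreover have "(vertex_integrand 3 l has_contour_integral ?L r) (circlepath 0 r)"
      by (rule *) (use that in simp_all)
    ultimately show ?thesis by (simp only:)
  qed
  moreover have "(vertex_integrand 3 l has_contour_integral ?J) (circlepath 0 r)"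
    if "1 < r" for r
  proof -
    have "?L r = ?J" using that by simp
    moreover have "(vertex_integrand 3 l has_contour_integral ?L r) (circlepath 0 r)"
      by (rule *) (use that in simp_all)
    ultimately show ?thesis by (simp only:)
  qed
  ultimately show ?thesis
    unfolding has_vp_integral_def by (intro exI[of _ "?J - 1"] exI[of _ ?J] conjI allI impI)
qed

section \<open>Negative definite integer matrices\<close>

lemma sum_mat_mult_vec:
  assumes "A \<in> carrier_mat n n" "v \<in> carrier_vec n" "i < n"
  shows "vec_index (A *\<^sub>v v) i = (\<Sum>j<n. A $$ (i, j) * vec_index v j)"
  using assms by (simp add: scalar_prod_def atLeast0LessThan)

text \<open>
  For an eigenvector \<open>x + \<i> y\<close> of a real symmetric matrix the Hermitian form has the value
  \<open>Q x + Q y\<close>, which is real.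
\<close>

lemma eigenvalue_negative:
  fixes M :: "int Matrix.mat"
  assumes M: "M \<in> carrier_mat n n"
    and sym: "\<And>i j. i < n \<Longrightarrow> j < n \<Longrightarrow> M $$ (i, j) = M $$ (j, i)"
    and semidef: "\<And>x :: nat \<Rightarrow> real. (\<Sum>i<n. x i * (\<Sum>j<n. of_int (M $$ (i, j)) * x j)) \<le> 0"
    and det: "Determinant.det M \<noteq> 0"
    and e: "eigenvalue (map_mat complex_of_int M) e"
  shows "Im e = 0" "Re e < 0"
proof -
  let ?C = "map_mat complex_of_int M"
  have C: "?C \<in> carrier_mat n n" using M by simp
  obtain v where v: "v \<in> carrier_vec n" "v \<noteq> 0\<^sub>v n" "?C *\<^sub>v v = e \<cdot>\<^sub>v v"
    using e C unfolding eigenvalue_def eigenvector_def by auto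
  define c where "c i = vec_index v i" for i
  define x where "x i = Re (c i)" for i
  define y where "y i = Im (c i)" for i
  define W where "W = (\<Sum>i<n. (x i)\<^sup>2 + (y i)\<^sup>2)"
  let ?m = "\<lambda>i j. real_of_int (M $$ (i, j))"
  have row: "(\<Sum>j<n. of_int (M $$ (i, j)) * c j) = e * c i" if "i < n" for i
  proof -
    have "vec_index (?C *\<^sub>v v) i = (\<Sum>j<n. ?C $$ (i, j) * vec_index v j)"
      by (rule sum_mat_mult_vec[OF C v(1) that])
    then show ?thesis using v that M by (simp add: c_def)
  qed
  have re: "(\<Sum>j<n. ?m i j * x j) = Re e * x i - Im e * y i"
    and im: "(\<Sum>j<n. ?m i j * y j) = Re e * y i + Im e * x i" if "i < n" for i
    using arg_cong[OF row[OF that], of Re] arg_cong[OF row[OF that], of Im]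
    by (simp_all add: x_def y_def algebra_simps)
  have W: "W > 0"
  proof -
    obtain i where i: "i < n" "c i \<noteq> 0"
      using v(1,2) by (auto simp: c_def vec_eq_iff)
    then have "(x i)\<^sup>2 + (y i)\<^sup>2 > 0"
      by (simp add: x_def y_def complex_eq_iff sum_power2_gt_zero_iff)
    then show ?thesis
      unfolding W_def using i by (intro sum_pos2[of _ i]) auto
  qed
  have "Re e * W = (\<Sum>i<n. Re e * ((x i)\<^sup>2 + (y i)\<^sup>2))"
    by (simp add: W_def sum_distrib_left)
  also have "\<dots> = (\<Sum>i<n. x i * (\<Sum>j<n. ?m i j * x j) + y i * (\<Sum>j<n. ?m i j * y j))"
    by (intro sum.cong refl, subst re, simp, subst im, simp)
      (simp add: power2_eq_square algebra_simps)
  also have "\<dots> = (\<Sum>i<n. x i * (\<Sum>j<n. ?m i j * x j)) + (\<Sum>i<n. y i * (\<Sum>j<n. ?m i j * y j))"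
    by (rule sum.distrib)
  also have "\<dots> \<le> 0" using semidef[of x] semidef[of y] by simp
  finally have "Re e \<le> 0" using W by (simp add: mult_le_0_iff)
  have "Im e * W = (\<Sum>i<n. Im e * ((x i)\<^sup>2 + (y i)\<^sup>2))"
    by (simp add: W_def sum_distrib_left)
  also have "\<dots> = (\<Sum>i<n. x i * (\<Sum>j<n. ?m i j * y j) - y i * (\<Sum>j<n. ?m i j * x j))"
    by (intro sum.cong refl, subst re, simp, subst im, simp)
      (simp add: power2_eq_square algebra_simps)
  also have "\<dots> = (\<Sum>i<n. x i * (\<Sum>j<n. ?m i j * y j)) - (\<Sum>i<n. y i * (\<Sum>j<n. ?m i j * x j))"
    by (rule sum_subtractf)
  also have "(\<Sum>i<n. y i * (\<Sum>j<n. ?m i j * x j)) = (\<Sum>i<n. \<Sum>j<n. ?m i j * x j * y i)"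
    by (simp add: sum_distrib_left mult_ac)
  also have "\<dots> = (\<Sum>j<n. \<Sum>i<n. ?m i j * x j * y i)" by (rule sum.swap)
  also have "\<dots> = (\<Sum>j<n. \<Sum>i<n. ?m j i * x j * y i)"
    by (intro sum.cong refl) (use sym in auto)
  also have "\<dots> = (\<Sum>i<n. x i * (\<Sum>j<n. ?m i j * y j))"
    by (simp add: sum_distrib_left mult_ac)
  finally show "Im e = 0" using W by simp
  \<comment> \<open>A semidefinite form suffices, because a zero eigenvalue contradicts the determinant.\<close>
  have "e \<noteq> 0"
  proof
    assume "e = 0"
    then have "Determinant.det ?C = 0"
      unfolding det_0_iff_vec_prod_zero[OF C] using v by (intro exI[of _ v]) auto
    moreover have "Determinant.det ?C = of_int (Determinant.det M)" by simp
    ultimately show False using det by simp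
  qed
  with \<open>Im e = 0\<close> \<open>Re e \<le> 0\<close> show "Re e < 0" by (auto simp: complex_eq_iff)
qed

lemma order_prod_linear_factors:
  "Polynomial.order x (\<Prod>b\<leftarrow>bs. [:- b, 1:]) = count_list bs (x :: 'a :: idom)"
proof (induction bs)
  case (Cons b bs)
  have "(\<Prod>b\<leftarrow>b # bs. [:- b, 1:]) \<noteq> 0" by (subst prod_list_zero_iff) auto
  then have "Polynomial.order x (\<Prod>b\<leftarrow>b # bs. [:- b, 1:])
      = Polynomial.order x [:- b, 1:] + Polynomial.order x (\<Prod>b\<leftarrow>bs. [:- b, 1:])"
    unfolding list.map prod_list.Cons by (rule order_mult)
  moreover have "Polynomial.order x [:- b, 1:] = (if b = x then 1 else 0)"
  proof (cases "b = x")
    case True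
    then show ?thesis using order_power_n_n[of x 1] by simp
  next
    case False
    then show ?thesis by (simp add: order_0I)
  qed
  ultimately show ?case using Cons by simp
qed simp

text \<open>
  Over the complex numbers the characteristic polynomial splits, and its roots are real; so it splits
  over the reals and the multiplicities of the negative roots add up to \<open>n\<close>.
\<close>

lemma eigenvalue_counts_negative_definite:
  fixes M :: "int Matrix.mat"
  assumes M: "M \<in> carrier_mat n n"
    and sym: "\<And>i j. i < n \<Longrightarrow> j < n \<Longrightarrow> M $$ (i, j) = M $$ (j, i)"
    and semidef: "\<And>x :: nat \<Rightarrow> real. (\<Sum>i<n. x i * (\<Sum>j<n. of_int (M $$ (i, j)) * x j)) \<le> 0"
    and det: "Determinant.det M \<noteq> 0"
  shows "num_pos_eigenvalues M = 0" "num_neg_eigenvalues M = n"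
proof -
  let ?A = "map_mat real_of_int M" and ?C = "map_mat complex_of_int M"
  have A: "?A \<in> carrier_mat n n" and C: "?C \<in> carrier_mat n n" using M by auto
  have CA: "?C = map_mat complex_of_real ?A" by (rule eq_matI) auto
  obtain as where as: "char_poly ?C = (\<Prod>a\<leftarrow>as. [:- a, 1:])" "length as = n"
    using char_poly_factorized[OF C] by blast
  define bs where "bs = map Re as"
  have neg: "Im a = 0" "Re a < 0" if "a \<in> set as" for a
  proof -
    have "poly (char_poly ?C) a = 0" unfolding as(1) using that
      by (induction as) (auto)
    then have "eigenvalue ?C a" by (simp add: eigenvalue_root_char_poly[OF C])
    then show "Im a = 0" "Re a < 0" using eigenvalue_negative[OF assms] by auto
  qed
  have asb: "as = map of_real bs"
    unfolding bs_def map_map by (rule map_idI[symmetric]) (use neg in \<open>auto simp: complex_eq_iff\<close>)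
  have "map_poly complex_of_real (char_poly ?A) = char_poly ?C"
    unfolding CA by (rule of_real_hom.char_poly_hom[OF A, symmetric])
  also have "\<dots> = map_poly complex_of_real (\<Prod>b\<leftarrow>bs. [:- b, 1:])"
  proof -
    interpret map_poly_hom: map_poly_comm_ring_hom complex_of_real ..
    show ?thesis
      unfolding as(1) asb map_poly_hom.hom_prod_list map_map
      by (intro arg_cong[of _ _ prod_list] map_cong refl) simp
  qed
  finally have cp: "char_poly ?A = (\<Prod>b\<leftarrow>bs. [:- b, 1:])"
    by (simp add: poly_eq_iff coeff_map_poly)
  have ev: "eigenvalue ?A x \<longleftrightarrow> x \<in> set bs" for x
    unfolding eigenvalue_root_char_poly[OF A] cp by (induction bs) auto
  have bneg: "b < 0" if "b \<in> set bs" for b using that neg by (auto simp: bs_def)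
  have "{x. eigenvalue ?A x \<and> 0 < x} = {}" using ev bneg by force
  then show "num_pos_eigenvalues M = 0" by (simp only: num_pos_eigenvalues_def Let_def sum.empty)
  have "{x. eigenvalue ?A x \<and> x < 0} = set bs" using ev bneg by auto
  then have "num_neg_eigenvalues M = (\<Sum>x\<in>set bs. count_list bs x)"
    by (simp only: num_neg_eigenvalues_def Let_def cp order_prod_linear_factors)
  also have "\<dots> = n" using as(2) by (simp add: sum_count_set bs_def)
  finally show "num_neg_eigenvalues M = n" .
qed

lemma inv_form_integer_inverse:
  assumes M: "M \<in> carrier_mat n n" and B: "B \<in> carrier_mat n n" "M * B = 1\<^sub>m n" "B * M = 1\<^sub>m n"
    and l: "l \<in> carrier_vec n"
  shows "inv_form M l = of_int (\<Sum>i<n. vec_index l i * (\<Sum>j<n. B $$ (i, j) * vec_index l j))"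
proof -
  let ?M = "map_mat rat_of_int M" and ?B = "map_mat rat_of_int B" and ?l = "map_vec rat_of_int l"
  have carr: "?M \<in> carrier_mat n n" "?B \<in> carrier_mat n n" "?l \<in> carrier_vec n" using M B l by auto
  have one: "map_mat rat_of_int (1\<^sub>m n) = 1\<^sub>m n" by (rule eq_matI) auto
  have MB: "?M * ?B = 1\<^sub>m n" "?B * ?M = 1\<^sub>m n"
    using B M by (simp_all add: one flip: of_int_hom.mat_hom_mult)
  have "?M \<in> Units (ring_mat TYPE(rat) n ())"
    unfolding Units_def using carr MB by (auto simp: ring_mat_simps intro!: bexI[of _ ?B])
  then have "mat_inverse ?M \<noteq> None" using mat_inverse(1)[OF carr(1), where b = "()"] by metis
  then obtain B' where B': "mat_inverse ?M = Some B'" by (meson option.exhaust)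
  then have B'1: "B' * ?M = 1\<^sub>m n" "B' \<in> carrier_mat n n" using mat_inverse(2)[OF carr(1) B'] by auto
  have "B' = B' * (?M * ?B)" using B'1 MB by simp
  also have "\<dots> = ?B" using assoc_mult_mat[OF B'1(2) carr(1,2)] B'1(1) carr by simp
  finally have "inv_form M l = scalar_prod ?l (?B *\<^sub>v ?l)"
    by (simp add: inv_form_def B' Let_def)
  also have "\<dots> = (\<Sum>i<n. vec_index ?l i * (\<Sum>j<n. ?B $$ (i, j) * vec_index ?l j))"
    using carr by (simp add: scalar_prod_def atLeast0LessThan)
  finally show ?thesis using B l by simp
qed

section \<open>Formal series\<close>

text \<open>
  A reduced indexing set picks one vector for each exponent that occurs, so its exponents are the
  support of the series and the extremal value in the definition is the lowest exponent.
\<close>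

lemma Delta_eqI:
  assumes rat: "\<And>r. Zhat G a r \<in> \<rat>"
    and d: "Zhat G a d \<noteq> 0" and low: "\<And>r. r < d \<Longrightarrow> Zhat G a r = 0"
  shows "Delta G a = d"
proof -
  let ?e = "Zhat_exponent G" and ?S = "{r. Zhat G a r \<noteq> 0}"
  let ?f = "\<lambda>l. inv_form (linking_matrix G) l / 4"
  have e: "?e l = Zhat_prefactor_exponent G - ?f l" for l by (simp add: Zhat_exponent_def)
  have single: "qsum I c ?e (?e l) = c l"
    if "inj_on ?e I" "l \<in> I" "c l \<noteq> 0" for I c l
  proof -
    have "{x \<in> I. c x \<noteq> 0 \<and> ?e x = ?e l} = {l}" using that by (auto dest: inj_onD)
    then show ?thesis by (simp add: qsum_def)
  qed
  have empty: "qsum I c ?e r = 0" if "r \<notin> ?e ` I" for I c r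
  proof -
    have "{x \<in> I. c x \<noteq> 0 \<and> ?e x = r} = {}" using that by auto
    then show ?thesis by (simp only: qsum_def sum.empty)
  qed
  have support: "?e ` I = ?S" if red: "reduced_indexing_set G a I" for I
  proof -
    obtain c where c: "inj_on ?e I" "\<forall>l\<in>I. c l \<in> \<rat> - {0}" "Zhat G a = qsum I c ?e"
      using red unfolding reduced_indexing_set_def by blast
    show ?thesis
    proof (intro equalityI subsetI)
      fix r assume "r \<in> ?e ` I"
      then obtain l where l: "l \<in> I" "r = ?e l" by blast
      with c(2) have "c l \<noteq> 0" by blast
      with single[OF c(1) l(1)] show "r \<in> ?S" by (simp add: c(3) l(2))
    next
      fix r assume "r \<in> ?S"
      then show "r \<in> ?e ` I" using empty[of r I c] c(3) by auto
    qed
  qed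
  have "\<exists>I. reduced_indexing_set G a I"
  proof -
    have "\<exists>l. l \<in> spinc_class G a \<and> ?e l = r" if "r \<in> ?S" for r
    proof (rule ccontr)
      assume "\<not> ?thesis"
      then have "r \<notin> ?e ` spinc_class G a" by blast
      from empty[OF this] that show False by (simp add: Zhat_def)
    qed
    then obtain g where g: "\<And>r. r \<in> ?S \<Longrightarrow> g r \<in> spinc_class G a \<and> ?e (g r) = r"
      by metis
    have inj: "inj_on ?e (g ` ?S)" using g by (auto simp: inj_on_def)
    have "Zhat G a = qsum (g ` ?S) (\<lambda>l. Zhat G a (?e l)) ?e"
    proof
      fix r
      show "Zhat G a r = qsum (g ` ?S) (\<lambda>l. Zhat G a (?e l)) ?e r"
      proof (cases "r \<in> ?S")
        case True
        then show ?thesis using single[OF inj, of "g r" "\<lambda>l. Zhat G a (?e l)"] g[OF True] by auto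
      next
        case False
        then have "r \<notin> ?e ` g ` ?S" using g by auto
        from empty[OF this] False show ?thesis by simp
      qed
    qed
    then have "reduced_indexing_set G a (g ` ?S)"
      unfolding reduced_indexing_set_def using g inj rat
      by (intro conjI exI[of _ "\<lambda>l. Zhat G a (?e l)"]) auto
    then show ?thesis ..
  qed
  then obtain I where I: "reduced_indexing_set G a I" ..
  have attained: "\<exists>l\<in>J. ?e l = d" if "reduced_indexing_set G a J" for J
  proof -
    have "d \<in> ?e ` J" unfolding support[OF that] using d by simp
    then show ?thesis by auto
  qed
  then obtain l where l: "l \<in> I" "?e l = d" using I by blast
  have ge: "d \<le> ?e l'" if "reduced_indexing_set G a J" "l' \<in> J" for J l'
  proof -
    have "Zhat G a (?e l') \<noteq> 0" using support[OF that(1)] that(2) by blast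
    then show ?thesis using low by (meson not_less)
  qed
  show ?thesis unfolding Delta_def
  proof (rule the_equality)
    show "\<exists>I m. reduced_indexing_set G a I \<and> m \<in> ?f ` I \<and> (\<forall>l\<in>I. ?f l \<le> m)
        \<and> d = Zhat_prefactor_exponent G - m"
    proof (intro exI[of _ I] exI[of _ "?f l"] conjI ballI)
      fix l' assume "l' \<in> I"
      with ge[OF I this] l show "?f l' \<le> ?f l" by (simp add: e)
    qed (use I l e in auto)
  next
    fix d' assume "\<exists>I m. reduced_indexing_set G a I \<and> m \<in> ?f ` I \<and> (\<forall>l\<in>I. ?f l \<le> m)
        \<and> d' = Zhat_prefactor_exponent G - m"
    then obtain J m where J: "reduced_indexing_set G a J" "m \<in> ?f ` J" "\<forall>l\<in>J. ?f l \<le> m"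
        "d' = Zhat_prefactor_exponent G - m" by blast
    obtain l' where l': "l' \<in> J" "?e l' = d'" using J by (auto simp: e)
    obtain l'' where l'': "l'' \<in> J" "?e l'' = d" using attained[OF J(1)] by blast
    have "d \<le> d'" using ge[OF J(1) l'(1)] l'(2) by simp
    moreover have "d' \<le> d" using J(3,4) l'' by (auto simp: e)
    ultimately show "d' = d" by simp
  qed
qed

lemma false_theta_square:
  assumes "0 < p"
  shows "false_theta p \<alpha> (of_nat (m\<^sup>2) / of_int (4 * p)) = of_int (false_theta_coeff p \<alpha> m)"
proof -
  have "{n \<in> UNIV. complex_of_int (false_theta_coeff p \<alpha> n) \<noteq> 0
      \<and> (of_nat (n\<^sup>2) / of_int (4 * p) :: rat) = of_nat (m\<^sup>2) / of_int (4 * p)}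
    = (if false_theta_coeff p \<alpha> m = 0 then {} else {m})"
  proof -
    have "(of_nat (n\<^sup>2) / of_int (4 * p) :: rat) = of_nat (m\<^sup>2) / of_int (4 * p) \<longleftrightarrow> n = m" for n
    proof -
      have "(of_nat (n\<^sup>2) / of_int (4 * p) :: rat) = of_nat (m\<^sup>2) / of_int (4 * p)
          \<longleftrightarrow> (of_nat (n\<^sup>2) :: rat) = of_nat (m\<^sup>2)"
        using assms by (simp only: divide_cancel_right) auto
      also have "\<dots> \<longleftrightarrow> n\<^sup>2 = m\<^sup>2" by (rule of_nat_eq_iff)
      also have "\<dots> \<longleftrightarrow> n = m" by simp
      finally show ?thesis .
    qed
    then show ?thesis by (simp only: of_int_eq_0_iff) auto
  qed
  then show ?thesis by (simp only: false_theta_def qsum_def) simp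
qed

lemma false_theta_nonsquare:
  assumes "\<And>m::nat. r \<noteq> of_nat (m\<^sup>2) / of_int (4 * p)"
  shows "false_theta p \<alpha> r = 0"
proof -
  have "{n \<in> UNIV. complex_of_int (false_theta_coeff p \<alpha> n) \<noteq> 0
      \<and> of_nat (n\<^sup>2) / of_int (4 * p) = r} = {}"
    using assms by auto
  then show ?thesis by (simp only: false_theta_def qsum_def sum.empty)
qed

section \<open>The linking matrix of the three-legged tree\<close>

definition neighbours :: "plumbing \<Rightarrow> nat \<Rightarrow> nat set" where
  "neighbours G i = {j. j < nverts G \<and> j \<noteq> i \<and> {i, j} \<in> edges G}"

lemma linking_matrix_carrier: "linking_matrix G \<in> carrier_mat (nverts G) (nverts G)"
  by (simp add: linking_matrix_def)

lemma linking_matrix_sym: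
  "i < nverts G \<Longrightarrow> j < nverts G \<Longrightarrow> linking_matrix G $$ (i, j) = linking_matrix G $$ (j, i)"
  by (auto simp: linking_matrix_def insert_commute)

lemma linking_matrix_row:
  fixes x :: "nat \<Rightarrow> 'a :: comm_ring_1"
  assumes "i < nverts G"
  shows "(\<Sum>j<nverts G. of_int (linking_matrix G $$ (i, j)) * x j)
    = of_int (weight G i) * x i + (\<Sum>j\<in>neighbours G i. x j)"
proof -
  have "(\<Sum>j<nverts G. of_int (linking_matrix G $$ (i, j)) * x j)
      = of_int (weight G i) * x i
        + (\<Sum>j\<in>{..<nverts G} - {i}. of_int (linking_matrix G $$ (i, j)) * x j)"
    using assms by (subst sum.remove[of _ i]) (auto simp: linking_matrix_def)
  also have "(\<Sum>j\<in>{..<nverts G} - {i}. of_int (linking_matrix G $$ (i, j)) * x j)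
      = (\<Sum>j\<in>{..<nverts G} - {i}. if {i, j} \<in> edges G then x j else 0)"
    using assms by (intro sum.cong refl) (auto simp: linking_matrix_def)
  also have "\<dots> = (\<Sum>j\<in>{j \<in> {..<nverts G} - {i}. {i, j} \<in> edges G}. x j)"
    by (rule sum.inter_filter[symmetric]) simp
  also have "{j \<in> {..<nverts G} - {i}. {i, j} \<in> edges G} = neighbours G i"
    by (auto simp: neighbours_def)
  finally show ?thesis .
qed

lemma linking_matrix_del_vertex:
  assumes "v < nverts G"
  shows "linking_matrix (del_vertex v G) = mat_delete (linking_matrix G) v v"
proof (rule eq_matI)
  fix i j assume "i < dim_row (mat_delete (linking_matrix G) v v)"
    "j < dim_col (mat_delete (linking_matrix G) v v)"
  then have ij: "i < nverts G - 1" "j < nverts G - 1" by (auto simp: linking_matrix_def)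
  have "insert_index v i = insert_index v j \<longleftrightarrow> i = j" by (auto simp: insert_index_def split: if_splits)
  then show "linking_matrix (del_vertex v G) $$ (i, j) = mat_delete (linking_matrix G) v v $$ (i, j)"
    using ij by (auto simp: linking_matrix_def del_vertex_def mat_delete_def insert_index_def insert_commute)
qed (simp_all add: linking_matrix_def del_vertex_def)

lemma doubleton_in_leg_edges:
  "{i, j} \<in> leg_edges u n \<longleftrightarrow> i = 0 \<and> j = u \<or> i = u \<and> j = 0
    \<or> u \<le> i \<and> j = i + 1 \<and> j < u + n \<or> u \<le> j \<and> i = j + 1 \<and> i < u + n"
proof -
  have "(\<exists>k. {i, j} = {u + k, u + k + 1} \<and> k + 1 < n)
      \<longleftrightarrow> u \<le> i \<and> j = i + 1 \<and> j < u + n \<or> u \<le> j \<and> i = j + 1 \<and> i < u + n" (is "?l \<longleftrightarrow> ?r")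
  proof
    assume ?l
    then show ?r by (auto simp: doubleton_eq_iff)
  next
    assume ?r
    then show ?l
      by (intro exI[of _ "min i j - u"]) (auto simp: doubleton_eq_iff)
  qed
  then show ?thesis by (auto simp: leg_edges_def doubleton_eq_iff)
qed

text \<open>The legs, each given by its first vertex and its continued fraction.\<close>

definition legs :: "int list \<Rightarrow> int list \<Rightarrow> int list \<Rightarrow> (nat \<times> int list) set" where
  "legs k1 k2 k3 = {(1, k1), (1 + length k1, k2), (1 + length k1 + length k2, k3)}"

lemma nverts_three_leg_tree:
  "nverts (three_leg_tree b k1 k2 k3) = 1 + length k1 + length k2 + length k3"
  by (simp add: three_leg_tree_def Let_def)

lemma edge_three_leg_tree:
  "e \<in> edges (three_leg_tree b k1 k2 k3) \<longleftrightarrow> (\<exists>(u, ks) \<in> legs k1 k2 k3. e \<in> leg_edges u (length ks))"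
  by (auto simp: three_leg_tree_def Let_def legs_def)

lemma weight_three_leg_tree_0: "weight (three_leg_tree b k1 k2 k3) 0 = b"
  by (simp add: three_leg_tree_def Let_def)

lemma weight_three_leg_tree_leg:
  "(u, ks) \<in> legs k1 k2 k3 \<Longrightarrow> j < length ks
    \<Longrightarrow> weight (three_leg_tree b k1 k2 k3) (u + j) = - ks ! j"
  by (auto simp: three_leg_tree_def Let_def legs_def nth_append)

lemma leg_less_nverts:
  "(u, ks) \<in> legs k1 k2 k3 \<Longrightarrow> j < length ks \<Longrightarrow> u + j < nverts (three_leg_tree b k1 k2 k3)"
  by (auto simp: legs_def nverts_three_leg_tree)

lemma neighbours_three_leg_tree_0:
  assumes "k1 \<noteq> []" "k2 \<noteq> []" "k3 \<noteq> []"
  shows "neighbours (three_leg_tree b k1 k2 k3) 0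
    = {1, 1 + length k1, 1 + length k1 + length k2}"
proof -
  have "length k1 > 0" "length k2 > 0" "length k3 > 0" using assms by auto
  then show ?thesis
    by (auto simp: neighbours_def edge_three_leg_tree legs_def nverts_three_leg_tree
        doubleton_in_leg_edges)
qed

lemma leg_edge_outside:
  assumes "v \<noteq> 0" "v < u \<or> u + n \<le> v" "0 < n"
  shows "{v, i} \<notin> leg_edges u n"
  unfolding doubleton_in_leg_edges using assms by linarith

lemma leg_edge_inside:
  assumes "0 < u" "j < n"
  shows "{u + j, i} \<in> leg_edges u n
    \<longleftrightarrow> i = (if j = 0 then 0 else u + (j - 1)) \<or> Suc j < n \<and> i = u + Suc j"
  unfolding doubleton_in_leg_edges using assms by (cases j) auto

lemma neighbours_three_leg_tree_leg:
  assumes ne: "k1 \<noteq> []" "k2 \<noteq> []" "k3 \<noteq> []" and leg: "(u, ks) \<in> legs k1 k2 k3" "j < length ks"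
  shows "neighbours (three_leg_tree b k1 k2 k3) (u + j)
    = insert (if j = 0 then 0 else u + (j - 1)) (if Suc j < length ks then {u + Suc j} else {})"
proof -
  let ?G = "three_leg_tree b k1 k2 k3"
  define v where "v = (if j = 0 then 0 else u + (j - 1))"
  have u: "0 < u" using leg by (auto simp: legs_def)
  have other: "{u + j, i} \<notin> leg_edges u' (length ks')"
    if "(u', ks') \<in> legs k1 k2 k3" "(u', ks') \<noteq> (u, ks)" for i u' ks'
  proof (rule leg_edge_outside)
    show "u + j < u' \<or> u' + length ks' \<le> u + j" using that leg by (auto simp: legs_def)
    show "0 < length ks'" using that ne by (auto simp: legs_def)
  qed (use u in simp)
  have "{u + j, i} \<in> edges ?G \<longleftrightarrow> {u + j, i} \<in> leg_edges u (length ks)" for i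
    unfolding edge_three_leg_tree using other leg(1) by fastforce
  then have edge: "{u + j, i} \<in> edges ?G \<longleftrightarrow> i = v \<or> Suc j < length ks \<and> i = u + Suc j" for i
    by (simp only: leg_edge_inside[OF u leg(2)] v_def)
  have "u + j < nverts ?G"
    by (rule leg_less_nverts[OF leg])
  then have v: "v < nverts ?G" "v \<noteq> u + j" unfolding v_def using u by arith+
  have "next": "u + Suc j < nverts ?G" if "Suc j < length ks"
    by (rule leg_less_nverts[OF leg(1) that])
  have "i \<in> neighbours ?G (u + j) \<longleftrightarrow> i = v \<or> Suc j < length ks \<and> i = u + Suc j" for i
    unfolding neighbours_def mem_Collect_eq edge using v "next" by fastforce
  then show ?thesis unfolding v_def[symmetric] by auto
qed

lemma sum_lessThan_add:
  fixes f :: "nat \<Rightarrow> 'a :: comm_monoid_add"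
  shows "(\<Sum>i<m + n. f i) = (\<Sum>i<m. f i) + (\<Sum>j<n. f (m + j))"
  by (induction n) (simp_all add: add.assoc)

lemma sum_three_leg_tree:
  fixes f :: "nat \<Rightarrow> 'a :: comm_monoid_add"
  shows "(\<Sum>i<nverts (three_leg_tree b k1 k2 k3). f i) = f 0 + (\<Sum>j<length k1. f (1 + j))
    + (\<Sum>j<length k2. f (1 + length k1 + j)) + (\<Sum>j<length k3. f (1 + length k1 + length k2 + j))"
  unfolding nverts_three_leg_tree sum_lessThan_add by simp

lemma vertex_three_leg_tree_cases:
  assumes "i < nverts (three_leg_tree b k1 k2 k3)"
  obtains "i = 0" | u ks j where "(u, ks) \<in> legs k1 k2 k3" "j < length ks" "i = u + j"
proof (cases "i = 0")
  case False
  consider "i < 1 + length k1" | "1 + length k1 \<le> i" "i < 1 + length k1 + length k2"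
    | "1 + length k1 + length k2 \<le> i" by linarith
  then have "\<exists>u ks j. (u, ks) \<in> legs k1 k2 k3 \<and> j < length ks \<and> i = u + j"
  proof cases
    case 1
    then show ?thesis using False
      by (intro exI[of _ 1] exI[of _ k1] exI[of _ "i - 1"]) (auto simp: legs_def)
  next
    case 2
    then show ?thesis
      by (intro exI[of _ "1 + length k1"] exI[of _ k2] exI[of _ "i - (1 + length k1)"])
        (auto simp: legs_def)
  next
    case 3
    then show ?thesis using assms
      by (intro exI[of _ "1 + length k1 + length k2"] exI[of _ k3]
          exI[of _ "i - (1 + length k1 + length k2)"])
        (auto simp: legs_def nverts_three_leg_tree)
  qed
  then show ?thesis using that(2) by blast
qed (use that in simp)

section \<open>Inverting the linking matrix\<close>

text \<open>
  The equation \<open>seifert\<close> says that \<open>b + a\<^sub>1 / b\<^sub>1 + a\<^sub>2 / b\<^sub>2 + a\<^sub>3 / b\<^sub>3 = - 1 / (b\<^sub>1 b\<^sub>2 b\<^sub>3)\<close>; in particular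
  every \<open>a\<^sub>i / b\<^sub>i\<close> is in lowest terms.
\<close>

locale brieskorn_tree =
  fixes b1 b2 b3 b a1 a2 a3 :: int and k1 k2 k3 :: "int list"
  assumes b_pos: "0 < b1" "0 < b2" "0 < b3"
    and a_pos: "0 < a1" "0 < a2" "0 < a3"
    and seifert: "b1 * b2 * b3 * b + b2 * b3 * a1 + b1 * b3 * a2 + b1 * b2 * a3 = -1"
    and cfrac: "cfrac_of k1 (of_int b1 / of_int a1)" "cfrac_of k2 (of_int b2 / of_int a2)"
      "cfrac_of k3 (of_int b3 / of_int a3)"
begin

definition G :: plumbing where "G = three_leg_tree b k1 k2 k3"
definition s :: nat where "s = nverts G"
definition M :: "int Matrix.mat" where "M = linking_matrix G"

text \<open>First and terminal vertices of the legs.\<close>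

definition u1 :: nat where "u1 = 1"
definition u2 :: nat where "u2 = 1 + length k1"
definition u3 :: nat where "u3 = 1 + length k1 + length k2"
definition t1 :: nat where "t1 = length k1"
definition t2 :: nat where "t2 = length k1 + length k2"
definition t3 :: nat where "t3 = length k1 + length k2 + length k3"

lemma legs_nonempty: "k1 \<noteq> []" "k2 \<noteq> []" "k3 \<noteq> []"
  using cfrac by (auto simp: cfrac_of_def)

lemma legs_eq: "legs k1 k2 k3 = {(u1, k1), (u2, k2), (u3, k3)}"
  by (simp add: legs_def u1_def u2_def u3_def)

lemma terminal_eq: "u1 + (length k1 - 1) = t1" "u2 + (length k2 - 1) = t2" "u3 + (length k3 - 1) = t3"
proof -
  have "length k1 > 0" "length k2 > 0" "length k3 > 0" using legs_nonempty by auto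
  then show "u1 + (length k1 - 1) = t1" "u2 + (length k2 - 1) = t2" "u3 + (length k3 - 1) = t3"
    unfolding u1_def u2_def u3_def t1_def t2_def t3_def by linarith+
qed

lemma vertex_order: "0 < s" "0 < t1" "t1 < u2" "u2 \<le> t2" "t2 < u3" "u3 \<le> t3" "t3 < s"
proof -
  have "length k1 > 0" "length k2 > 0" "length k3 > 0" using legs_nonempty by auto
  then show "0 < s" "0 < t1" "t1 < u2" "u2 \<le> t2" "t2 < u3" "u3 \<le> t3" "t3 < s"
    unfolding u1_def u2_def u3_def t1_def t2_def t3_def s_def G_def nverts_three_leg_tree
    by linarith+
qed

lemma M_carrier: "M \<in> carrier_mat s s"
  using linking_matrix_carrier by (simp add: M_def s_def)

lemma M_sym: "i < s \<Longrightarrow> j < s \<Longrightarrow> M $$ (i, j) = M $$ (j, i)"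
  by (simp add: M_def s_def linking_matrix_sym)

lemma coprime_ab: "coprime b1 a1" "coprime b2 a2" "coprime b3 a3"
proof -
  have unit: "coprime x y" if "x * c + y * d = -1" for x y c d :: int
  proof (rule coprimeI)
    fix e assume "e dvd x" "e dvd y"
    then have "e dvd x * c + y * d" by simp
    then show "is_unit e" unfolding that by simp
  qed
  show "coprime b1 a1"
    by (rule unit[of _ "b2 * b3 * b + b3 * a2 + b2 * a3" _ "b2 * b3"])
      (use seifert in \<open>simp add: algebra_simps\<close>)
  show "coprime b2 a2"
    by (rule unit[of _ "b1 * b3 * b + b3 * a1 + b1 * a3" _ "b1 * b3"])
      (use seifert in \<open>simp add: algebra_simps\<close>)
  show "coprime b3 a3"
    by (rule unit[of _ "b1 * b2 * b + b2 * a1 + b1 * a2" _ "b1 * b2"])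
      (use seifert in \<open>simp add: algebra_simps\<close>)
qed

lemma continuants:
  "continuant k1 = b1" "continuant (tl k1) = a1"
  "continuant k2 = b2" "continuant (tl k2) = a2"
  "continuant k3 = b3" "continuant (tl k3) = a3"
  using cfrac_of_continuants[OF cfrac(1) coprime_ab(1) b_pos(1) a_pos(1)]
    cfrac_of_continuants[OF cfrac(2) coprime_ab(2) b_pos(2) a_pos(2)]
    cfrac_of_continuants[OF cfrac(3) coprime_ab(3) b_pos(3) a_pos(3)] by auto

lemma row_centre:
  fixes x :: "nat \<Rightarrow> 'a :: comm_ring_1"
  shows "(\<Sum>j<s. of_int (M $$ (0, j)) * x j) = of_int b * x 0 + x u1 + x u2 + x u3"
proof -
  have "length k1 > 0" "length k2 > 0" using legs_nonempty by auto
  then have "(\<Sum>j\<in>neighbours G 0. x j) = x u1 + x u2 + x u3"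
    using neighbours_three_leg_tree_0[OF legs_nonempty, of b]
    by (simp add: G_def u1_def u2_def u3_def add.assoc)
  moreover have "0 < nverts G" using vertex_order by (simp add: s_def)
  ultimately show ?thesis
    unfolding s_def M_def using linking_matrix_row[of 0 G x]
    by (simp add: weight_three_leg_tree_0 add.assoc G_def)
qed

lemma row_leg:
  fixes x :: "nat \<Rightarrow> 'a :: comm_ring_1"
  assumes leg: "(u, ks) \<in> legs k1 k2 k3" "j < length ks"
  shows "(\<Sum>i<s. of_int (M $$ (u + j, i)) * x i) = leg_row ks (x 0) (\<lambda>j. x (u + j)) j"
proof -
  have "u \<noteq> 0" using leg by (auto simp: legs_def)
  then have "(\<Sum>i\<in>neighbours G (u + j). x i)
    = (if j = 0 then x 0 else x (u + (j - 1))) + (if Suc j < length ks then x (u + Suc j) else 0)"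
    unfolding G_def neighbours_three_leg_tree_leg[OF legs_nonempty leg] by auto
  then show ?thesis
    unfolding s_def M_def G_def
    using linking_matrix_row[OF leg_less_nverts[OF leg], of b x]
    by (simp add: weight_three_leg_tree_leg[OF leg] leg_row_def G_def)
qed

text \<open>
  A vector in the kernel modulo \<open>d\<close> is determined by its terminal entries \<open>\<tau>\<^sub>i\<close>, which satisfy
  \<open>b\<^sub>i \<tau>\<^sub>i = x\<^sub>0\<close>; eliminating with the row of the centre leaves \<open>- \<tau>\<^sub>i = 0\<close> by the equation
  \<open>seifert\<close>.  So \<open>M\<close> is injective modulo every \<open>d\<close>, including \<open>d = 0\<close>.
\<close>

lemma kernel_mod_trivial:
  fixes x :: "nat \<Rightarrow> int"
  assumes ker: "\<And>i. i < s \<Longrightarrow> [(\<Sum>j<s. M $$ (i, j) * x j) = 0] (mod d)" and "i < s"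
  shows "[x i = 0] (mod d)"
proof -
  have leg: "[x 0 = continuant ks * x (u + (length ks - 1))] (mod d)
      \<and> [x u = continuant (tl ks) * x (u + (length ks - 1))] (mod d)
      \<and> (\<forall>j<length ks. \<exists>c. [x (u + j) = c * x (u + (length ks - 1))] (mod d))"
    if "(u, ks) \<in> legs k1 k2 k3" for u ks
  proof -
    have "[leg_row ks (x 0) (\<lambda>j. x (u + j)) j = 0] (mod d)" if j: "j < length ks" for j
      using ker[of "u + j"] row_leg[OF \<open>(u, ks) \<in> legs k1 k2 k3\<close> j, of x]
        leg_less_nverts[OF \<open>(u, ks) \<in> legs k1 k2 k3\<close> j] by (simp add: s_def G_def)
    moreover have "ks \<noteq> []" using that legs_nonempty by (auto simp: legs_def)
    ultimately show ?thesis using leg_kernel_cong[of ks "x 0" "\<lambda>j. x (u + j)" d] by simp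
  qed
  have D: "d dvd x 0 - b1 * x t1" "d dvd x u1 - a1 * x t1" "d dvd x 0 - b2 * x t2"
    "d dvd x u2 - a2 * x t2" "d dvd x 0 - b3 * x t3" "d dvd x u3 - a3 * x t3"
    using leg[of u1 k1] leg[of u2 k2] leg[of u3 k3]
    by (simp_all add: legs_eq continuants terminal_eq[unfolded One_nat_def] cong_iff_dvd_diff)
  have centre: "d dvd b * x 0 + x u1 + x u2 + x u3"
    using ker[of 0] row_centre[of x] vertex_order by (simp add: cong_iff_dvd_diff)
  have elim: "d dvd \<tau>1"
    if "d dvd y - c1 * \<tau>1" "d dvd v1 - e1 * \<tau>1" "d dvd y - c2 * \<tau>2" "d dvd v2 - e2 * \<tau>2"
      "d dvd y - c3 * \<tau>3" "d dvd v3 - e3 * \<tau>3" "d dvd b * y + v1 + v2 + v3"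
      "c1 * c2 * c3 * b + c2 * c3 * e1 + c1 * c3 * e2 + c1 * c2 * e3 = -1"
    for y v1 v2 v3 \<tau>1 \<tau>2 \<tau>3 c1 c2 c3 e1 e2 e3 :: int
  proof -
    \<comment> \<open>Multiply the row of the centre by \<open>c2 * c3\<close> and use \<open>c2 * \<tau>2 = y = c1 * \<tau>1\<close>, and likewise for \<open>\<tau>3\<close>.\<close>
    have "\<tau>1 = - \<tau>1 * (c1 * c2 * c3 * b + c2 * c3 * e1 + c1 * c3 * e2 + c1 * c2 * e3)"
      using that(8) by simp
    also have "\<dots> = b * c2 * c3 * (y - c1 * \<tau>1) + c2 * c3 * (v1 - e1 * \<tau>1)
        + (e2 * c3 * ((y - c1 * \<tau>1) - (y - c2 * \<tau>2)) + c2 * c3 * (v2 - e2 * \<tau>2))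
        + (e3 * c2 * ((y - c1 * \<tau>1) - (y - c3 * \<tau>3)) + c2 * c3 * (v3 - e3 * \<tau>3))
        - c2 * c3 * (b * y + v1 + v2 + v3)"
      by (simp add: algebra_simps)
    finally show ?thesis
      using that(1-7) by (metis dvd_add dvd_diff dvd_mult)
  qed
  have terminal: "d dvd x t1" "d dvd x t2" "d dvd x t3"
    subgoal by (rule elim[OF D centre seifert])
    subgoal
      by (rule elim[OF D(3,4,1,2,5,6)]) (use centre seifert in \<open>simp_all add: algebra_simps\<close>)
    subgoal
      by (rule elim[OF D(5,6,1,2,3,4)]) (use centre seifert in \<open>simp_all add: algebra_simps\<close>)
    done
  have "i < nverts (three_leg_tree b k1 k2 k3)" using \<open>i < s\<close> by (simp add: s_def G_def)
  then show ?thesis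
  proof (cases rule: vertex_three_leg_tree_cases)
    case 1
    have "d dvd (x 0 - b1 * x t1) + b1 * x t1"
      by (intro dvd_add D dvd_mult terminal)
    then show ?thesis using 1 by (simp add: cong_iff_dvd_diff)
  next
    case (2 u ks j)
    have "d dvd x (u + (length ks - 1))"
      using 2(1) terminal terminal_eq by (auto simp: legs_eq)
    moreover obtain c where "d dvd x i - c * x (u + (length ks - 1))"
      using leg[OF 2(1)] 2(2,3) by (auto simp: cong_iff_dvd_diff)
    ultimately have "d dvd (x i - c * x (u + (length ks - 1))) + c * x (u + (length ks - 1))"
      by (intro dvd_add dvd_mult)
    then show ?thesis by (simp add: cong_iff_dvd_diff)
  qed
qed

lemma det_M_nonzero: "Determinant.det M \<noteq> 0"
proof
  assume "Determinant.det M = 0"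
  then obtain v where v: "v \<in> carrier_vec s" "v \<noteq> 0\<^sub>v s" "M *\<^sub>v v = 0\<^sub>v s"
    unfolding det_0_iff_vec_prod_zero[OF M_carrier] by blast
  have "vec_index v i = 0" if "i < s" for i
  proof -
    have "[vec_index v i = 0] (mod 0)"
    proof (rule kernel_mod_trivial[OF _ that])
      fix i assume "i < s"
      with sum_mat_mult_vec[OF M_carrier v(1) this] v(3)
      show "[(\<Sum>j<s. M $$ (i, j) * vec_index v j) = 0] (mod 0)" by simp
    qed
    then show ?thesis by simp
  qed
  then show False using v(1,2) by (auto simp: vec_eq_iff)
qed

text \<open>
  Modulo \<open>det M\<close> the columns of the adjugate lie in the kernel, so the adjugate is divisible by the
  determinant and \<open>M\<close> is invertible over the integers.
\<close>

definition B :: "int Matrix.mat" where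
  "B = Matrix.mat s s (\<lambda>(i, j). adj_mat M $$ (i, j) div Determinant.det M)"

lemma B_carrier: "B \<in> carrier_mat s s"
  by (simp add: B_def)

lemma adj_eq_det_B: "adj_mat M = Determinant.det M \<cdot>\<^sub>m B"
proof (rule eq_matI)
  fix i j assume "i < dim_row (Determinant.det M \<cdot>\<^sub>m B)" "j < dim_col (Determinant.det M \<cdot>\<^sub>m B)"
  then have ij: "i < s" "j < s" by (auto simp: B_def)
  have "[adj_mat M $$ (i, j) = 0] (mod Determinant.det M)"
  proof (rule kernel_mod_trivial[OF _ ij(1)])
    fix i assume i: "i < s"
    have "(M * adj_mat M) $$ (i, j) = (\<Sum>k<s. M $$ (i, k) * adj_mat M $$ (k, j))"
      using i ij(2) M_carrier adj_mat(1)[OF M_carrier]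
      by (simp add: scalar_prod_def atLeast0LessThan)
    then have "(\<Sum>k<s. M $$ (i, k) * adj_mat M $$ (k, j)) = Determinant.det M * (1\<^sub>m s $$ (i, j))"
      using i ij(2) by (simp add: adj_mat(2)[OF M_carrier])
    then show "[(\<Sum>k<s. M $$ (i, k) * adj_mat M $$ (k, j)) = 0] (mod Determinant.det M)"
      by (simp only: cong_0_iff dvd_triv_left)
  qed
  then show "adj_mat M $$ (i, j) = (Determinant.det M \<cdot>\<^sub>m B) $$ (i, j)"
    using ij by (simp add: B_def cong_0_iff)
qed (use adj_mat(1)[OF M_carrier] in \<open>auto simp: B_def\<close>)

lemma M_B: "M * B = 1\<^sub>m s" and B_M: "B * M = 1\<^sub>m s"
proof -
  have cancel: "A = 1\<^sub>m s" if "A \<in> carrier_mat s s"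
    "Determinant.det M \<cdot>\<^sub>m A = Determinant.det M \<cdot>\<^sub>m 1\<^sub>m s" for A
  proof (rule eq_matI)
    fix i j assume "i < dim_row (1\<^sub>m s :: int Matrix.mat)" "j < dim_col (1\<^sub>m s :: int Matrix.mat)"
    then have ij: "i < s" "j < s" by auto
    then have "(Determinant.det M \<cdot>\<^sub>m A) $$ (i, j) = (Determinant.det M \<cdot>\<^sub>m 1\<^sub>m s) $$ (i, j)"
      using that by simp
    then show "A $$ (i, j) = 1\<^sub>m s $$ (i, j)"
      using ij that(1) det_M_nonzero by (simp split: if_splits)
  qed (use that(1) in auto)
  show "M * B = 1\<^sub>m s"
  proof (rule cancel)
    show "Determinant.det M \<cdot>\<^sub>m (M * B) = Determinant.det M \<cdot>\<^sub>m 1\<^sub>m s"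
      using adj_mat(2)[OF M_carrier] mult_smult_distrib[OF M_carrier B_carrier]
      by (simp add: adj_eq_det_B)
  qed (use M_carrier B_carrier in simp)
  show "B * M = 1\<^sub>m s"
  proof (rule cancel)
    show "Determinant.det M \<cdot>\<^sub>m (B * M) = Determinant.det M \<cdot>\<^sub>m 1\<^sub>m s"
      using adj_mat(3)[OF M_carrier] mult_smult_assoc_mat[OF B_carrier M_carrier]
      by (simp add: adj_eq_det_B)
  qed (use M_carrier B_carrier in simp)
qed

lemma M_B_entry:
  "i < s \<Longrightarrow> j < s \<Longrightarrow> (\<Sum>k<s. M $$ (i, k) * B $$ (k, j)) = (if i = j then 1 else 0)"
  using arg_cong[OF M_B, of "\<lambda>A. A $$ (i, j)"] M_carrier B_carrier
  by (simp add: scalar_prod_def atLeast0LessThan)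

lemma B_sym:
  assumes "i < s" "j < s"
  shows "B $$ (i, j) = B $$ (j, i)"
proof -
  have Mt: "transpose_mat M = M"
    using M_carrier M_sym by (intro eq_matI) auto
  have "transpose_mat B = transpose_mat B * (M * B)" using B_carrier by (simp add: M_B)
  also have "\<dots> = (transpose_mat B * M) * B"
    using B_carrier M_carrier by (intro assoc_mult_mat[symmetric, of _ s s _ s]) auto
  also have "transpose_mat B * M = transpose_mat (M * B)"
    using transpose_mult[OF M_carrier B_carrier] by (simp add: Mt)
  also have "\<dots> = 1\<^sub>m s" by (simp add: M_B)
  finally have "transpose_mat B = B" using B_carrier by simp
  then show ?thesis using assms B_carrier by (metis carrier_matD index_transpose_mat(1))
qed

lemma abs_det_M: "\<bar>Determinant.det M\<bar> = 1"
proof -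
  have "Determinant.det M * Determinant.det B = 1"
    using det_mult[OF M_carrier B_carrier] by (simp add: M_B)
  then have "\<bar>Determinant.det M * Determinant.det B\<bar> = 1" by simp
  then show ?thesis by (rule abs_zmult_eq_1)
qed

text \<open>
  Each leg contributes at most \<open>x\<^sub>0\<^sup>2 a\<^sub>i / b\<^sub>i\<close> to the quadratic form, so the whole form is at most
  \<open>- x\<^sub>0\<^sup>2 / (b\<^sub>1 b\<^sub>2 b\<^sub>3)\<close>.
\<close>

lemma M_form_nonpos:
  fixes x :: "nat \<Rightarrow> real"
  shows "(\<Sum>i<s. x i * (\<Sum>j<s. of_int (M $$ (i, j)) * x j)) \<le> 0"
proof -
  define R where "R i = (\<Sum>j<s. of_int (M $$ (i, j)) * x j)" for i
  have leg: "x 0 * x u + (\<Sum>j<length ks. x (u + j) * R (u + j))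
      \<le> (x 0)\<^sup>2 * of_int (continuant (tl ks)) / of_int (continuant ks)"
    if l: "(u, ks) \<in> legs k1 k2 k3" for u ks
  proof -
    have ks: "ks \<noteq> []" "\<forall>k\<in>set (tl ks). 2 \<le> k" "continuant ks > 0"
      using l cfrac b_pos by (auto simp: legs_eq cfrac_of_def continuants)
    show ?thesis
      using leg_form_le[OF ks, of "x 0" "\<lambda>j. x (u + j)"]
      by (simp add: R_def row_leg[OF l] cong: sum.cong_simp)
  qed
  have "(\<Sum>i<s. x i * R i) = x 0 * R 0 + (\<Sum>j<length k1. x (u1 + j) * R (u1 + j))
      + (\<Sum>j<length k2. x (u2 + j) * R (u2 + j)) + (\<Sum>j<length k3. x (u3 + j) * R (u3 + j))"
    unfolding s_def G_def sum_three_leg_tree u1_def u2_def u3_def ..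
  also have "R 0 = of_int b * x 0 + x u1 + x u2 + x u3"
    unfolding R_def by (rule row_centre)
  also have "x 0 * (of_int b * x 0 + x u1 + x u2 + x u3)
      + (\<Sum>j<length k1. x (u1 + j) * R (u1 + j)) + (\<Sum>j<length k2. x (u2 + j) * R (u2 + j))
      + (\<Sum>j<length k3. x (u3 + j) * R (u3 + j))
    \<le> of_int b * (x 0)\<^sup>2 + (x 0)\<^sup>2 * of_int a1 / of_int b1 + (x 0)\<^sup>2 * of_int a2 / of_int b2
      + (x 0)\<^sup>2 * of_int a3 / of_int b3"
    using leg[of u1 k1] leg[of u2 k2] leg[of u3 k3]
    by (simp add: legs_eq continuants power2_eq_square algebra_simps)
  also have "\<dots> = (x 0)\<^sup>2 * of_int (b1 * b2 * b3 * b + b2 * b3 * a1 + b1 * b3 * a2 + b1 * b2 * a3)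
      / of_int (b1 * b2 * b3)"
    using b_pos by (simp add: field_simps)
  also have "\<dots> \<le> 0" unfolding seifert using b_pos by simp
  finally show ?thesis by (simp only: R_def)
qed

lemma num_pos_M: "num_pos_eigenvalues M = 0" and signature_M: "signature M = - int s"
  using eigenvalue_counts_negative_definite[OF M_carrier M_sym M_form_nonpos det_M_nonzero]
  by (simp_all add: signature_def)

text \<open>
  A column of \<open>B\<close> solves the homogeneous rows of every leg that does not contain its index, so its
  entries along that leg are continuants times the terminal entry.
\<close>

lemma B_column_leg:
  assumes l: "(u, ks) \<in> legs k1 k2 k3" and k: "k < s" "k < u \<or> u + length ks \<le> k"
  shows "B $$ (0, k) = continuant ks * B $$ (u + (length ks - 1), k)"
    "B $$ (u, k) = continuant (tl ks) * B $$ (u + (length ks - 1), k)"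
proof -
  have ks: "ks \<noteq> []" using l legs_nonempty by (auto simp: legs_def)
  have "leg_row ks (B $$ (0, k)) (\<lambda>j. B $$ (u + j, k)) j = 0" if j: "j < length ks" for j
  proof -
    have "u + j < s" using leg_less_nverts[OF l j] by (simp add: s_def G_def)
    then show ?thesis
      using row_leg[OF l j, of "\<lambda>i. B $$ (i, k)"] M_B_entry[of "u + j" k] k j by auto
  qed
  then show "B $$ (0, k) = continuant ks * B $$ (u + (length ks - 1), k)"
    "B $$ (u, k) = continuant (tl ks) * B $$ (u + (length ks - 1), k)"
    using leg_kernel_cong[OF ks, of "B $$ (0, k)" "\<lambda>j. B $$ (u + j, k)" 0] by simp_all
qed

text \<open>
  All three legs are homogeneous for the column of the centre, and its remaining equation is the row
  of the centre.
\<close>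

lemma B_centre: "B $$ (0, 0) = - (b1 * b2 * b3)" "B $$ (t1, 0) = - (b2 * b3)"
  "B $$ (t2, 0) = - (b1 * b3)" "B $$ (t3, 0) = - (b1 * b2)"
proof -
  have cancel: "x = y" if "c * x = c * y" "0 < c" for c x y :: int
    using that by simp
  let ?x = "\<lambda>i. B $$ (i, 0)"
  have pos: "u1 > 0" "u2 > 0" "u3 > 0" by (auto simp: u1_def u2_def u3_def)
  have leg: "?x 0 = b1 * ?x t1" "?x u1 = a1 * ?x t1" "?x 0 = b2 * ?x t2" "?x u2 = a2 * ?x t2"
    "?x 0 = b3 * ?x t3" "?x u3 = a3 * ?x t3"
    using B_column_leg[of u1 k1 0] B_column_leg[of u2 k2 0] B_column_leg[of u3 k3 0] pos vertex_order
    by (simp_all add: legs_eq continuants terminal_eq[unfolded One_nat_def])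
  have "b * ?x 0 + ?x u1 + ?x u2 + ?x u3 = 1"
    using row_centre[of ?x] M_B_entry[of 0 0] vertex_order by simp
  then have "b1 * b2 * b3 = b1 * b2 * b3 * (b * ?x 0 + a1 * ?x t1 + a2 * ?x t2 + a3 * ?x t3)"
    using leg by simp
  also have "\<dots> = b1 * b2 * b3 * b * ?x 0 + b2 * b3 * a1 * (b1 * ?x t1) + b1 * b3 * a2 * (b2 * ?x t2)
      + b1 * b2 * a3 * (b3 * ?x t3)"
    by (simp add: algebra_simps)
  also have "\<dots> = (b1 * b2 * b3 * b + b2 * b3 * a1 + b1 * b3 * a2 + b1 * b2 * a3) * ?x 0"
    by (simp only: leg(1,3,5)[symmetric]) (simp add: algebra_simps)
  finally show x0: "?x 0 = - (b1 * b2 * b3)" by (simp add: seifert)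
  have eqs: "b1 * ?x t1 = b1 * - (b2 * b3)" "b2 * ?x t2 = b2 * - (b1 * b3)" "b3 * ?x t3 = b3 * - (b1 * b2)"
    using leg(1,3,5) x0 by (simp_all add: algebra_simps)
  show "?x t1 = - (b2 * b3)" "?x t2 = - (b1 * b3)" "?x t3 = - (b1 * b2)"
    by (rule cancel[OF eqs(1) b_pos(1)] cancel[OF eqs(2) b_pos(2)] cancel[OF eqs(3) b_pos(3)])+
qed

text \<open>
  For the column of a terminal vertex the two other legs are homogeneous, and the entry at the centre
  is known by symmetry.
\<close>

lemma B_terminals: "B $$ (t2, t1) = - b3" "B $$ (t3, t1) = - b2" "B $$ (t3, t2) = - b1"
proof -
  have cancel: "x = y" if "c * x = c * y" "0 < c" for c x y :: int
    using that by simp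
  have len: "u1 + length k1 = u2" "u2 + length k2 = u3" "u3 + length k3 = s"
    by (auto simp: u1_def u2_def u3_def s_def G_def nverts_three_leg_tree)
  have "B $$ (0, t1) = b2 * B $$ (t2, t1)" "B $$ (0, t1) = b3 * B $$ (t3, t1)"
    "B $$ (0, t2) = b3 * B $$ (t3, t2)"
    using B_column_leg(1)[of u2 k2 t1] B_column_leg(1)[of u3 k3 t1] B_column_leg(1)[of u3 k3 t2]
      vertex_order by (simp_all add: legs_eq continuants terminal_eq[unfolded One_nat_def] len)
  moreover have "B $$ (0, t1) = - (b2 * b3)" "B $$ (0, t2) = - (b1 * b3)"
    using B_centre B_sym[of 0 t1] B_sym[of 0 t2] vertex_order by auto
  ultimately have eqs: "b2 * B $$ (t2, t1) = b2 * - b3" "b3 * B $$ (t3, t1) = b3 * - b2"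
    "b3 * B $$ (t3, t2) = b3 * - b1"
    by (metis mult.commute mult_minus_right)+
  show "B $$ (t2, t1) = - b3" "B $$ (t3, t1) = - b2" "B $$ (t3, t2) = - b1"
    by (rule cancel[OF eqs(1) b_pos(2)] cancel[OF eqs(2) b_pos(3)] cancel[OF eqs(3) b_pos(3)])+
qed

text \<open>
  The absolute value is a cofactor divided by a unit; the sign is that of the value of the form at the
  corresponding column of \<open>B\<close>.
\<close>

lemma B_diagonal:
  assumes t: "t < s"
  shows "B $$ (t, t) = - \<bar>Determinant.det (linking_matrix (del_vertex t G))\<bar>"
proof -
  let ?x = "\<lambda>i. real_of_int (B $$ (i, t))"
  have "(\<Sum>j<s. of_int (M $$ (i, j)) * ?x j) = (if i = t then 1 else 0)" if "i < s" for i
  proof -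
    have "(\<Sum>j<s. of_int (M $$ (i, j)) * ?x j) = of_int (\<Sum>j<s. M $$ (i, j) * B $$ (j, t))"
      by simp
    then show ?thesis using M_B_entry[OF that t] by simp
  qed
  then have "(\<Sum>i<s. ?x i * (\<Sum>j<s. of_int (M $$ (i, j)) * ?x j)) = (\<Sum>i<s. if i = t then ?x i else 0)"
    by (intro sum.cong refl) auto
  also have "\<dots> = ?x t" using t by simp
  finally have "B $$ (t, t) \<le> 0" using M_form_nonpos[of ?x] by simp
  moreover have "\<bar>B $$ (t, t)\<bar> = \<bar>Determinant.det (linking_matrix (del_vertex t G))\<bar>"
  proof -
    have "adj_mat M $$ (t, t) = Determinant.det (linking_matrix (del_vertex t G))"
      using t M_carrier linking_matrix_del_vertex[of t G]
      by (simp add: adj_mat_def cofactor_def M_def s_def)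
    moreover have "adj_mat M $$ (t, t) = Determinant.det M * B $$ (t, t)"
      using t B_carrier by (simp add: adj_eq_det_B)
    ultimately have "\<bar>Determinant.det (linking_matrix (del_vertex t G))\<bar>
        = \<bar>Determinant.det M\<bar> * \<bar>B $$ (t, t)\<bar>" by (metis abs_mult)
    then show ?thesis by (simp add: abs_det_M)
  qed
  ultimately show ?thesis by linarith
qed

end

section \<open>The series as a sum over signs and odd integers\<close>

text \<open>The principal value at a vertex of degree \<open>d \<in> {1, 2, 3}\<close>; for \<open>d = 3\<close> only odd \<open>l\<close> occur.\<close>

definition vertex_value :: "nat \<Rightarrow> int \<Rightarrow> complex" where
  "vertex_value d l = (if d = 3 then of_int (sgn l) / 2
     else if d = 1 then (if l = -1 then 1 else 0) - (if l = 1 then 1 else 0)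
     else if l = 0 then 1 else 0)"

context brieskorn_tree
begin

lemma vertex_distinct: "0 \<noteq> t1" "0 \<noteq> t2" "0 \<noteq> t3" "t1 \<noteq> t2" "t1 \<noteq> t3" "t2 \<noteq> t3"
  "t1 < s" "t2 < s" "t3 < s"
  using vertex_order by auto

lemma vdeg_eq:
  assumes "i < s"
  shows "vdeg G i = (if i = 0 then 3 else if i \<in> {t1, t2, t3} then 1 else 2)"
proof -
  have card: "vdeg G i = card (neighbours G i)" for i
    by (simp add: vdeg_def neighbours_def)
  have "i < nverts (three_leg_tree b k1 k2 k3)" using assms by (simp add: s_def G_def)
  then show ?thesis
  proof (cases rule: vertex_three_leg_tree_cases)
    case 1
    have "length k1 > 0" "length k2 > 0" using legs_nonempty by auto
    then have "card (neighbours G 0) = 3"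
      unfolding G_def neighbours_three_leg_tree_0[OF legs_nonempty] by simp
    then show ?thesis using 1 card[of 0] by simp
  next
    case (2 u ks j)
    have u: "0 < u" using 2(1) by (auto simp: legs_def)
    have "card (neighbours G i) = (if Suc j < length ks then 2 else 1)"
      using u unfolding 2(3) G_def neighbours_three_leg_tree_leg[OF legs_nonempty 2(1,2)]
      by (auto simp: card_insert_if)
    then have "vdeg G i = (if Suc j < length ks then 2 else 1)"
      unfolding card[of i] .
    moreover have "Suc j = length ks \<longleftrightarrow> i \<in> {t1, t2, t3}"
    proof -
      have "u3 = t2 + 1" "u2 = t1 + 1" "t2 + length k3 = t3" "t1 + length k2 = t2" "u1 + length k1 = t1 + 1"
        by (auto simp: u1_def u2_def u3_def t1_def t2_def t3_def)
      note len = this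
      consider "u = u1" "length ks = length k1" | "u = u2" "length ks = length k2"
        | "u = u3" "length ks = length k3"
        using 2(1) by (auto simp: legs_eq)
      then show ?thesis
      proof cases
        case 1
        then have "i \<noteq> t2" "i \<noteq> t3" "Suc j = length ks \<longleftrightarrow> i = t1"
          using 2(2,3) len vertex_order by linarith+
        then show ?thesis by simp
      next
        case 2
        then have "i \<noteq> t1" "i \<noteq> t3" "Suc j = length ks \<longleftrightarrow> i = t2"
          using \<open>j < length ks\<close> \<open>i = u + j\<close> len vertex_order by linarith+
        then show ?thesis by simp
      next
        case 3
        then have "i \<noteq> t1" "i \<noteq> t2" "Suc j = length ks \<longleftrightarrow> i = t3"
          using 2(2,3) len vertex_order by linarith+
        then show ?thesis by simp
      qed
    qed
    ultimately show ?thesis using u 2(2,3) by auto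
  qed
qed

text \<open>Since \<open>M\<close> is unimodular, \<open>2 M \<int>\<^sup>s = 2 \<int>\<^sup>s\<close> and there is only one class.\<close>

lemma spinc_class_eq:
  assumes "a \<in> spinc_reps G"
  shows "spinc_class G a = spinc_reps G"
proof -
  obtain y where y: "y \<in> carrier_vec s" "a = 2 \<cdot>\<^sub>v y + degree_vec G"
    using assms by (auto simp: spinc_reps_def s_def)
  have d: "degree_vec G \<in> carrier_vec s" by (simp add: degree_vec_def s_def)
  have shift: "2 \<cdot>\<^sub>v z + a = 2 \<cdot>\<^sub>v (z + y) + degree_vec G" if "z \<in> carrier_vec s" for z
    using that y d by (intro eq_vecI) auto
  show ?thesis
  proof (intro equalityI subsetI)
    fix l assume "l \<in> spinc_class G a"
    then obtain x where x: "x \<in> carrier_vec s" "l = 2 \<cdot>\<^sub>v (M *\<^sub>v x) + a"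
      by (auto simp: spinc_class_def s_def M_def)
    then have "l = 2 \<cdot>\<^sub>v (M *\<^sub>v x + y) + degree_vec G"
      using shift[of "M *\<^sub>v x"] M_carrier by simp
    moreover have "M *\<^sub>v x + y \<in> carrier_vec s" using x y M_carrier by simp
    ultimately show "l \<in> spinc_reps G" unfolding spinc_reps_def s_def[symmetric] by blast
  next
    fix l assume "l \<in> spinc_reps G"
    then obtain x where x: "x \<in> carrier_vec s" "l = 2 \<cdot>\<^sub>v x + degree_vec G"
      by (auto simp: spinc_reps_def s_def)
    have "M *\<^sub>v (B *\<^sub>v (x - y)) = x - y"
      using assoc_mult_mat_vec[OF M_carrier B_carrier, of "x - y"] x y by (simp add: M_B)
    moreover have "x - y + y = x" using x y by (intro eq_vecI) auto
    ultimately have "l = 2 \<cdot>\<^sub>v (M *\<^sub>v (B *\<^sub>v (x - y))) + a"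
      using shift[of "x - y"] x y by simp
    moreover have "B *\<^sub>v (x - y) \<in> carrier_vec s" using x y B_carrier by simp
    ultimately show "l \<in> spinc_class G a"
      unfolding spinc_class_def s_def[symmetric] M_def[symmetric] by blast
  qed
qed

lemma spinc_reps_iff:
  "l \<in> spinc_reps G \<longleftrightarrow> l \<in> carrier_vec s \<and> (\<forall>i<s. even (vec_index l i - int (vdeg G i)))"
proof
  assume "l \<in> spinc_reps G"
  then show "l \<in> carrier_vec s \<and> (\<forall>i<s. even (vec_index l i - int (vdeg G i)))"
    by (auto simp: spinc_reps_def s_def degree_vec_def)
next
  assume l: "l \<in> carrier_vec s \<and> (\<forall>i<s. even (vec_index l i - int (vdeg G i)))"
  define x where "x = Matrix.vec s (\<lambda>i. (vec_index l i - int (vdeg G i)) div 2)"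
  have "l = 2 \<cdot>\<^sub>v x + degree_vec G"
    using l by (intro eq_vecI) (auto simp: x_def degree_vec_def s_def)
  moreover have "x \<in> carrier_vec s" by (simp add: x_def)
  ultimately show "l \<in> spinc_reps G" unfolding spinc_reps_def s_def[symmetric] by blast
qed

lemma Zhat_integral_prod:
  assumes "l \<in> spinc_reps G"
  shows "Zhat_integral G l = (\<Prod>i<s. vertex_value (vdeg G i) (vec_index l i))"
proof -
  let ?f = "\<lambda>i z. (z - 1 / z) powi (2 - int (vdeg G i)) * z powi (vec_index l i)"
  have "Zhat_integral G l = iterated_vp_integral s (\<lambda>zs. 1 * (\<Prod>i<s. ?f i (zs ! i)))"
    by (simp add: Zhat_integral_def s_def prod.distrib)
  also have "\<dots> = 1 * (\<Prod>i<s. vertex_value (vdeg G i) (vec_index l i))"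
  proof (rule iterated_vp_integral_prod)
    fix i assume i: "i < s"
    have "has_vp_integral (vertex_integrand (vdeg G i) (vec_index l i))
        (vertex_value (vdeg G i) (vec_index l i))"
    proof (cases "i = 0")
      case True
      have "vdeg G 0 = 3" using vdeg_eq[of 0] vertex_order by simp
      moreover have "odd (vec_index l 0)"
        using assms calculation vertex_order by (auto simp: spinc_reps_iff)
      ultimately show ?thesis
        using True has_vp_integral_vertex_3 by (simp add: vertex_value_def)
    next
      case False
      then have "vdeg G i = 1 \<or> vdeg G i = 2" using vdeg_eq[OF i] by auto
      then show ?thesis
        using has_vp_integral_vertex_1[of "vec_index l i"] has_vp_integral_vertex_2[of "vec_index l i"]
        by (elim disjE) (simp_all only: vertex_value_def, simp_all)
    qed
    then show "has_vp_integral (\<lambda>z. ?f i z / (2 * of_real pi * \<i> * z))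
        (vertex_value (vdeg G i) (vec_index l i))"
      by (simp add: vertex_integrand_def[abs_def])
  qed
  finally show ?thesis by simp
qed

text \<open>
  A vector with nonzero integral vanishes at the interior vertices of the legs, so it is determined by
  its entries at the centre and at the terminal vertices.
\<close>

definition end_vec :: "int \<Rightarrow> int \<Rightarrow> int \<Rightarrow> int \<Rightarrow> int Matrix.vec" where
  "end_vec n e1 e2 e3 = Matrix.vec s
     (\<lambda>i. if i = 0 then n else if i = t1 then e1 else if i = t2 then e2 else if i = t3 then e3 else 0)"

lemma end_vec_index:
  "i < s \<Longrightarrow> vec_index (end_vec n e1 e2 e3) i
    = (if i = 0 then n else if i = t1 then e1 else if i = t2 then e2 else if i = t3 then e3 else 0)"
  by (simp add: end_vec_def)

lemma end_vec_carrier: "end_vec n e1 e2 e3 \<in> carrier_vec s"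
  by (simp add: end_vec_def)

lemma prod_ends:
  fixes f :: "nat \<Rightarrow> 'a :: comm_monoid_mult"
  assumes "\<And>i. i < s \<Longrightarrow> i \<notin> {0, t1, t2, t3} \<Longrightarrow> f i = 1"
  shows "(\<Prod>i<s. f i) = f 0 * f t1 * f t2 * f t3"
proof -
  have "(\<Prod>i<s. f i) = (\<Prod>i\<in>{0, t1, t2, t3}. f i)"
    by (rule prod.mono_neutral_right) (use assms vertex_order in auto)
  then show ?thesis using vertex_distinct by (simp add: mult.assoc)
qed

lemma sum_ends:
  fixes f :: "nat \<Rightarrow> 'a :: comm_monoid_add"
  assumes "\<And>i. i < s \<Longrightarrow> i \<notin> {0, t1, t2, t3} \<Longrightarrow> f i = 0"
  shows "(\<Sum>i<s. f i) = f 0 + f t1 + f t2 + f t3"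
proof -
  have "(\<Sum>i<s. f i) = (\<Sum>i\<in>{0, t1, t2, t3}. f i)"
    by (rule sum.mono_neutral_right) (use assms vertex_order in auto)
  then show ?thesis using vertex_distinct by (simp add: add.assoc)
qed

lemma vdeg_ends: "vdeg G 0 = 3" "vdeg G t1 = 1" "vdeg G t2 = 1" "vdeg G t3 = 1"
  using vdeg_eq vertex_distinct vertex_order by auto

lemma end_vec_in_spinc_reps:
  assumes "odd n" "e1 \<in> {-1, 1}" "e2 \<in> {-1, 1}" "e3 \<in> {-1, 1}"
  shows "end_vec n e1 e2 e3 \<in> spinc_reps G"
  unfolding spinc_reps_iff using assms by (auto simp: end_vec_carrier end_vec_index vdeg_eq)

lemma Zhat_integral_end_vec:
  assumes "odd n" and e: "e1 \<in> {-1, 1}" "e2 \<in> {-1, 1}" "e3 \<in> {-1, 1}"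
  shows "Zhat_integral G (end_vec n e1 e2 e3) = - of_int (sgn n * e1 * e2 * e3) / 2"
proof -
  let ?l = "end_vec n e1 e2 e3"
  have val: "vertex_value 1 e = - of_int e" if "e \<in> {-1, 1}" for e
    using that by (auto simp: vertex_value_def)
  have "Zhat_integral G ?l = (\<Prod>i<s. vertex_value (vdeg G i) (vec_index ?l i))"
    by (rule Zhat_integral_prod[OF end_vec_in_spinc_reps[OF assms]])
  also have "\<dots> = vertex_value 3 n * vertex_value 1 e1 * vertex_value 1 e2 * vertex_value 1 e3"
    using vertex_distinct vertex_order
    by (subst prod_ends) (auto simp: vdeg_ends vdeg_eq end_vec_index vertex_value_def)
  also have "\<dots> = - of_int (sgn n * e1 * e2 * e3) / 2"
    by (simp only: val[OF e(1)] val[OF e(2)] val[OF e(3)]) (simp add: vertex_value_def)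
  finally show ?thesis .
qed

lemma Zhat_integral_nonzero_imp_end_vec:
  assumes l: "l \<in> spinc_reps G" and nz: "Zhat_integral G l \<noteq> 0"
  obtains n e1 e2 e3 where "odd n" "e1 \<in> {-1, 1}" "e2 \<in> {-1, 1}" "e3 \<in> {-1, 1}"
    "l = end_vec n e1 e2 e3"
proof -
  have v: "vertex_value (vdeg G i) (vec_index l i) \<noteq> 0" if "i < s" for i
    using nz that unfolding Zhat_integral_prod[OF l] by auto
  have ends: "vec_index l i \<in> {-1, 1}" if "i \<in> {t1, t2, t3}" for i
    using v[of i] that vertex_distinct vdeg_ends by (auto simp: vertex_value_def split: if_splits)
  have zero: "vec_index l i = 0" if "i < s" "i \<notin> {0, t1, t2, t3}" for i
    using v[of i] that vdeg_eq[of i] by (auto simp: vertex_value_def split: if_splits)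
  have "l = end_vec (vec_index l 0) (vec_index l t1) (vec_index l t2) (vec_index l t3)"
    using l zero by (intro eq_vecI) (auto simp: spinc_reps_iff end_vec_def)
  moreover have "odd (vec_index l 0)"
    using l vertex_order vdeg_ends by (auto simp: spinc_reps_iff)
  ultimately show ?thesis using that ends by blast
qed

definition h :: "nat \<Rightarrow> int" where
  "h t = \<bar>Determinant.det (linking_matrix (del_vertex t G))\<bar>"

definition p :: int where "p = b1 * b2 * b3"

definition xi :: rat where
  "xi = 1 / 4 * (of_int (h t1 + h t2 + h t3) - 3 * of_nat s - of_int (mat_trace M)
     - of_int (b2 * b3) / of_int b1 - of_int (b1 * b3) / of_int b2 - of_int (b1 * b2) / of_int b3)"

text \<open>This is \<open>p (e\<^sub>1 / b\<^sub>1 + e\<^sub>2 / b\<^sub>2 + e\<^sub>3 / b\<^sub>3)\<close>.\<close>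

definition offset :: "int \<times> int \<times> int \<Rightarrow> int" where
  "offset = (\<lambda>(e1, e2, e3). e1 * (b2 * b3) + e2 * (b1 * b3) + e3 * (b1 * b2))"

text \<open>The terms with \<open>h\<close> do not depend on the signs because \<open>e\<^sub>i\<^sup>2 = 1\<close>.\<close>

lemma inv_form_end_vec:
  assumes e: "e1 \<in> {-1, 1}" "e2 \<in> {-1, 1}" "e3 \<in> {-1, 1}"
  shows "inv_form M (end_vec n e1 e2 e3) = of_int
    (- p * n\<^sup>2 - 2 * n * offset (e1, e2, e3) - (h t1 + h t2 + h t3)
     - 2 * (e1 * e2 * b3 + e1 * e3 * b2 + e2 * e3 * b1))"
proof -
  let ?l = "end_vec n e1 e2 e3"
  have sq: "e1 * e1 = 1" "e2 * e2 = 1" "e3 * e3 = 1" using e by auto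
  have row: "(\<Sum>j<s. B $$ (i, j) * vec_index ?l j)
      = B $$ (i, 0) * n + B $$ (i, t1) * e1 + B $$ (i, t2) * e2 + B $$ (i, t3) * e3" for i
    using vertex_distinct vertex_order by (subst sum_ends) (auto simp: end_vec_index)
  have "(\<Sum>i<s. vec_index ?l i * (\<Sum>j<s. B $$ (i, j) * vec_index ?l j))
    = n * (B $$ (0, 0) * n + B $$ (0, t1) * e1 + B $$ (0, t2) * e2 + B $$ (0, t3) * e3)
    + e1 * (B $$ (t1, 0) * n + B $$ (t1, t1) * e1 + B $$ (t1, t2) * e2 + B $$ (t1, t3) * e3)
    + e2 * (B $$ (t2, 0) * n + B $$ (t2, t1) * e1 + B $$ (t2, t2) * e2 + B $$ (t2, t3) * e3)
    + e3 * (B $$ (t3, 0) * n + B $$ (t3, t1) * e1 + B $$ (t3, t2) * e2 + B $$ (t3, t3) * e3)"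
    unfolding row using vertex_distinct vertex_order
    by (subst sum_ends) (auto simp: end_vec_index)
  also have "\<dots> = - p * n\<^sup>2 - 2 * n * offset (e1, e2, e3)
      - (h t1 * (e1 * e1) + h t2 * (e2 * e2) + h t3 * (e3 * e3))
      - 2 * (e1 * e2 * b3 + e1 * e3 * b2 + e2 * e3 * b1)"
  proof -
    have "B $$ (0, t1) = - (b2 * b3)" "B $$ (0, t2) = - (b1 * b3)" "B $$ (0, t3) = - (b1 * b2)"
      "B $$ (t1, t2) = - b3" "B $$ (t1, t3) = - b2" "B $$ (t2, t3) = - b1"
      using B_sym[of 0 t1] B_sym[of 0 t2] B_sym[of 0 t3] B_sym[of t1 t2] B_sym[of t1 t3]
        B_sym[of t2 t3] vertex_distinct vertex_order B_centre B_terminals by simp_all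
    moreover have "B $$ (t, t) = - h t" if "t < s" for t
      using B_diagonal[OF that] by (simp add: h_def)
    ultimately show ?thesis
      using vertex_distinct B_centre B_terminals
      by (simp add: p_def offset_def power2_eq_square algebra_simps)
  qed
  finally show ?thesis
    unfolding sq inv_form_integer_inverse[OF M_carrier B_carrier M_B B_M end_vec_carrier]
    by (simp only: mult_1_right)
qed

text \<open>
  Completing the square in \<open>n\<close>: the square of the offset divided by \<open>p\<close> supplies the mixed terms
  \<open>2 e\<^sub>i e\<^sub>j b\<^sub>k\<close>, and its diagonal terms, constant because \<open>e\<^sub>i\<^sup>2 = 1\<close>, are the fractions in \<open>xi\<close>.
\<close>

lemma Zhat_exponent_end_vec:
  assumes e: "e1 \<in> {-1, 1}" "e2 \<in> {-1, 1}" "e3 \<in> {-1, 1}"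
  shows "Zhat_exponent G (end_vec n e1 e2 e3)
    = xi + of_int ((p * n + offset (e1, e2, e3))\<^sup>2) / of_int (4 * p)"
proof -
  let ?Q = "2 * (e1 * e2 * b3 + e1 * e3 * b2 + e2 * e3 * b1)"
  have p: "p > 0" using b_pos by (simp add: p_def)
  have sq: "e1 * e1 = 1" "e2 * e2 = 1" "e3 * e3 = 1" using e by auto
  have "(p * n + offset (e1, e2, e3))\<^sup>2 = p * (p * n\<^sup>2 + 2 * n * offset (e1, e2, e3) + ?Q)
      + ((e1 * e1) * (b2 * b3)\<^sup>2 + (e2 * e2) * (b1 * b3)\<^sup>2 + (e3 * e3) * (b1 * b2)\<^sup>2)"
    by (simp add: p_def offset_def power2_eq_square algebra_simps)
  also have "\<dots> = p * (p * n\<^sup>2 + 2 * n * offset (e1, e2, e3) + ?Q)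
      + ((b2 * b3)\<^sup>2 + (b1 * b3)\<^sup>2 + (b1 * b2)\<^sup>2)"
    by (simp only: sq mult_1)
  finally have "(of_int ((p * n + offset (e1, e2, e3))\<^sup>2) / of_int p :: rat)
      = of_int (p * n\<^sup>2 + 2 * n * offset (e1, e2, e3) + ?Q)
        + of_int ((b2 * b3)\<^sup>2 + (b1 * b3)\<^sup>2 + (b1 * b2)\<^sup>2) / of_int p"
    using p by (simp only: of_int_add of_int_mult add_divide_distrib) simp
  moreover have "(of_int ((b2 * b3)\<^sup>2 + (b1 * b3)\<^sup>2 + (b1 * b2)\<^sup>2) / of_int p :: rat)
      = of_int (b2 * b3) / of_int b1 + of_int (b1 * b3) / of_int b2 + of_int (b1 * b2) / of_int b3"
    using b_pos by (simp add: p_def field_simps power2_eq_square)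
  ultimately have sqr: "(of_int ((p * n + offset (e1, e2, e3))\<^sup>2) / of_int (4 * p) :: rat)
      = (of_int (p * n\<^sup>2 + 2 * n * offset (e1, e2, e3) + ?Q)
        + (of_int (b2 * b3) / of_int b1 + of_int (b1 * b3) / of_int b2
          + of_int (b1 * b2) / of_int b3)) / 4"
    by (simp add: field_simps)
  show ?thesis
    unfolding sqr Zhat_exponent_def Zhat_prefactor_exponent_def M_def[symmetric]
      inv_form_end_vec[OF e] xi_def signature_M
    by (simp add: diff_divide_distrib add_divide_distrib)
qed

definition signs :: "(int \<times> int \<times> int) set" where
  "signs = {-1, 1} \<times> {-1, 1} \<times> {-1, 1}"

definition sign_prod :: "int \<times> int \<times> int \<Rightarrow> int" where
  "sign_prod = (\<lambda>(e1, e2, e3). e1 * e2 * e3)"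

lemma Zhat_eq_sum:
  assumes "a \<in> spinc_reps G"
  shows "Zhat G a r = (\<Sum>(e, n) \<in> {(e, n). e \<in> signs \<and> odd n
      \<and> xi + of_int ((p * n + offset e)\<^sup>2) / of_int (4 * p) = r}.
    - of_int (sgn n * sign_prod e) / 2)"
    (is "_ = sum ?c ?Q")
proof -
  let ?v = "\<lambda>(e, n). case e of (e1, e2, e3) \<Rightarrow> end_vec n e1 e2 e3"
  have inj: "inj_on ?v ?Q"
  proof (rule inj_onI, clarify)
    fix e1 e2 e3 n e1' e2' e3' n'
    assume "end_vec n e1 e2 e3 = end_vec n' e1' e2' e3'"
    then have "vec_index (end_vec n e1 e2 e3) i = vec_index (end_vec n' e1' e2' e3') i" for i by simp
    from this[of 0] this[of t1] this[of t2] this[of t3]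
    show "((e1, e2, e3) = (e1', e2', e3')) \<and> n = n'"
      using vertex_distinct vertex_order by (simp add: end_vec_index split: if_splits)
  qed
  have set: "{l \<in> spinc_class G a. Zhat_integral G l \<noteq> 0 \<and> Zhat_exponent G l = r} = ?v ` ?Q"
  proof (intro equalityI subsetI)
    fix l assume "l \<in> {l \<in> spinc_class G a. Zhat_integral G l \<noteq> 0 \<and> Zhat_exponent G l = r}"
    then have l: "l \<in> spinc_reps G" "Zhat_integral G l \<noteq> 0" "Zhat_exponent G l = r"
      by (auto simp: spinc_class_eq[OF assms])
    obtain n e1 e2 e3 where ne: "odd n" "e1 \<in> {-1, 1}" "e2 \<in> {-1, 1}" "e3 \<in> {-1, 1}"
      "l = end_vec n e1 e2 e3"
      by (rule Zhat_integral_nonzero_imp_end_vec[OF l(1,2)])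
    have "(e1, e2, e3) \<in> signs" unfolding signs_def by (intro SigmaI ne(2-4))
    then have "((e1, e2, e3), n) \<in> ?Q"
      using ne(1) l(3) Zhat_exponent_end_vec[OF ne(2-4), of n] by (simp add: ne(5))
    then show "l \<in> ?v ` ?Q" by (rule rev_image_eqI) (simp add: ne(5))
  next
    fix l assume "l \<in> ?v ` ?Q"
    then obtain e1 e2 e3 n where ne: "(e1, e2, e3) \<in> signs" "odd n"
      "xi + of_int ((p * n + offset (e1, e2, e3))\<^sup>2) / of_int (4 * p) = r" "l = end_vec n e1 e2 e3"
      by auto
    then have e: "e1 \<in> {-1, 1}" "e2 \<in> {-1, 1}" "e3 \<in> {-1, 1}" by (auto simp: signs_def)
    have "Zhat_integral G l \<noteq> 0"
      using ne(2) e by (auto simp: ne(4) Zhat_integral_end_vec[OF ne(2) e] sgn_if)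
    then show "l \<in> {l \<in> spinc_class G a. Zhat_integral G l \<noteq> 0 \<and> Zhat_exponent G l = r}"
      using ne(3) end_vec_in_spinc_reps[OF ne(2) e] Zhat_exponent_end_vec[OF e, of n]
      by (simp add: ne(4) spinc_class_eq[OF assms])
  qed
  have "Zhat G a r = (\<Sum>l\<in>?v ` ?Q. Zhat_integral G l)"
    unfolding Zhat_def qsum_def set M_def[symmetric] num_pos_M by simp
  also have "\<dots> = (\<Sum>q\<in>?Q. Zhat_integral G (?v q))"
    using inj by (simp only: sum.reindex o_def)
  also have "\<dots> = sum ?c ?Q"
  proof (intro sum.cong refl, clarify)
    fix e1 e2 e3 n :: int
    assume "(e1, e2, e3) \<in> signs" "odd n"
    then show "Zhat_integral G (end_vec n e1 e2 e3) = - of_int (sgn n * sign_prod (e1, e2, e3)) / 2"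
      by (subst Zhat_integral_end_vec) (auto simp: signs_def sign_prod_def mult.assoc)
  qed
  finally show ?thesis .
qed

end

section \<open>Comparison with the false theta functions\<close>

text \<open>
  The inequality \<open>1 / b\<^sub>1 + 1 / b\<^sub>2 + 1 / b\<^sub>3 < 1\<close>, which fails among pairwise coprime triples
  only for \<open>(2, 3, 5)\<close>.
\<close>

lemma sum_pair_products_less_product:
  fixes b1 b2 b3 :: int
  assumes b: "1 < b1" "b1 < b2" "b2 < b3" and cop: "coprime b1 b2" "coprime b1 b3" "coprime b2 b3"
    and ne: "(b1, b2, b3) \<noteq> (2, 3, 5)"
  shows "b1 * b2 + b1 * b3 + b2 * b3 < b1 * b2 * b3"
proof -
  consider "b1 \<ge> 3" | "b1 = 2" "b2 \<ge> 4" | "b1 = 2" "b2 = 3" using b by linarith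
  then show ?thesis
  proof cases
    case 1
    have "3 * (b2 * b3) \<le> b1 * (b2 * b3)" using 1 b by (intro mult_right_mono) auto
    moreover have "b1 * b3 < b2 * b3" "b1 * b2 < b2 * b3"
      using b by (auto intro: mult_strict_right_mono simp: mult.commute[of b2 b3])
    ultimately show ?thesis by (simp add: mult.assoc)
  next
    case 2
    have "2 * 3 \<le> (b2 - 2) * (b3 - 2)" using 2 b by (intro mult_mono) auto
    then show ?thesis using 2 by (simp add: algebra_simps)
  next
    case 3
    have "b3 \<noteq> 4" "b3 \<noteq> 5" "b3 \<noteq> 6"
      using cop ne 3 by (auto simp: coprime_iff_gcd_eq_1)
    then have "b3 \<ge> 7" using b 3 by linarith
    then show ?thesis using 3 by simp
  qed
qed

text \<open>The residue classes of \<open>\<alpha>\<close> and \<open>- \<alpha>\<close> modulo \<open>2 p\<close> coincide only if \<open>p\<close> divides \<open>\<alpha>\<close>.\<close>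

lemma false_theta_coeff_eq:
  assumes "\<not> p dvd \<alpha>"
  shows "false_theta_coeff p \<alpha> n
    = of_bool [int n = \<alpha>] (mod 2 * p) - of_bool [int n = - \<alpha>] (mod 2 * p)"
proof -
  have "\<not> ([int n = \<alpha>] (mod 2 * p) \<and> [int n = - \<alpha>] (mod 2 * p))"
  proof
    assume "[int n = \<alpha>] (mod 2 * p) \<and> [int n = - \<alpha>] (mod 2 * p)"
    then have "[\<alpha> = - \<alpha>] (mod 2 * p)" using cong_sym cong_trans by blast
    then have "2 * p dvd 2 * \<alpha>" by (simp add: cong_iff_dvd_diff)
    then show False using assms by simp
  qed
  then show ?thesis by (auto simp: false_theta_coeff_def)
qed

locale brieskorn_sphere_tree = brieskorn_tree +
  assumes b1_greater_1: "1 < b1"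
    and b1_coprime: "coprime b1 b2" "coprime b1 b3"
    and hyperbolic: "b1 * b2 + b1 * b3 + b2 * b3 < b1 * b2 * b3"
begin

text \<open>
  The first sign \<open>-1\<close> gives the \<open>\<alpha>\<^sub>1, \<alpha>\<^sub>2, \<alpha>\<^sub>3, \<alpha>\<^sub>4\<close> of the theorem; changing all signs replaces \<open>\<alpha>\<close> by
  \<open>2 p - \<alpha>\<close>.
\<close>

definition \<alpha> :: "int \<times> int \<times> int \<Rightarrow> int" where
  "\<alpha> e = p + offset e"

lemma alpha_bounds:
  assumes "e \<in> signs"
  shows "\<alpha> (-1, -1, -1) \<le> \<alpha> e" "0 < \<alpha> e" "\<alpha> e < 2 * p"
    "\<alpha> e = \<alpha> (-1, -1, -1) \<longleftrightarrow> e = (-1, -1, -1)"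
proof -
  have bnd: "- x \<le> c * x" "c * x \<le> x" "c * x = - x \<longleftrightarrow> c = -1"
    if "c \<in> {-1, 1}" "0 < x" for c x :: int
    using that by auto
  have pos: "0 < b2 * b3" "0 < b1 * b3" "0 < b1 * b2" using b_pos by auto
  obtain e1 e2 e3 where e: "e = (e1, e2, e3)" "e1 \<in> {-1, 1}" "e2 \<in> {-1, 1}" "e3 \<in> {-1, 1}"
    using assms by (auto simp: signs_def)
  note bnds = bnd(1,2)[OF e(2) pos(1)] bnd(1,2)[OF e(3) pos(2)] bnd(1,2)[OF e(4) pos(3)]
  have a: "\<alpha> e = p + (e1 * (b2 * b3) + e2 * (b1 * b3) + e3 * (b1 * b2))"
    "\<alpha> (-1, -1, -1) = p - b2 * b3 - b1 * b3 - b1 * b2"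
    by (simp_all add: e(1) \<alpha>_def offset_def)
  have p: "b1 * b2 + b1 * b3 + b2 * b3 < p" using hyperbolic by (simp add: p_def)
  show "\<alpha> (-1, -1, -1) \<le> \<alpha> e" "0 < \<alpha> e" "\<alpha> e < 2 * p"
    using a p bnds by linarith+
  have "\<alpha> e = \<alpha> (-1, -1, -1) \<longleftrightarrow> e1 * (b2 * b3) = - (b2 * b3)
      \<and> e2 * (b1 * b3) = - (b1 * b3) \<and> e3 * (b1 * b2) = - (b1 * b2)"
    using a bnds by linarith
  then show "\<alpha> e = \<alpha> (-1, -1, -1) \<longleftrightarrow> e = (-1, -1, -1)"
    unfolding bnd(3)[OF e(2) pos(1)] bnd(3)[OF e(3) pos(2)] bnd(3)[OF e(4) pos(3)]
    by (simp add: e(1))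
qed

lemma p_pos: "0 < p"
  using b_pos by (simp add: p_def)

text \<open>Modulo \<open>b\<^sub>1\<close> only the summand \<open>e\<^sub>1 b\<^sub>2 b\<^sub>3\<close> survives, and it is prime to \<open>b\<^sub>1\<close>.\<close>

lemma not_p_dvd_alpha:
  assumes "e \<in> signs"
  shows "\<not> p dvd \<alpha> e"
proof
  assume "p dvd \<alpha> e"
  moreover have "b1 dvd p" by (simp add: p_def)
  ultimately have "b1 dvd \<alpha> e" by (rule dvd_trans[rotated])
  obtain e1 e2 e3 where e: "e = (e1, e2, e3)" "e1 \<in> {-1, 1}"
    using assms by (auto simp: signs_def)
  have "\<alpha> e = b1 * (b2 * b3 + e2 * b3 + e3 * b2) + e1 * (b2 * b3)"
    by (simp add: e(1) \<alpha>_def p_def offset_def algebra_simps)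
  with \<open>b1 dvd \<alpha> e\<close> have "b1 dvd e1 * (b2 * b3)"
    by (metis dvd_add_right_iff dvd_triv_left)
  then have "b1 dvd b2 * b3" using e(2) by auto
  then have "b1 dvd b3" using b1_coprime(1) by (simp add: coprime_dvd_mult_right_iff)
  then have "is_unit b1" using b1_coprime(2) by (meson coprime_common_divisor dvd_refl)
  then show False using b1_greater_1 by simp
qed

text \<open>
  As \<open>n\<close> runs through the odd integers, \<open>p n + offset e\<close> runs through the residue class of \<open>\<alpha> e\<close> modulo
  \<open>2 p\<close>; it is nonnegative only for \<open>n > 0\<close> because \<open>\<bar>offset e\<bar> < p\<close>.
\<close>

lemma odd_solution_unique:
  assumes e: "e \<in> signs" and m: "0 \<le> m"
  shows "{n. odd n \<and> p * n + offset e = m}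
    = (if [m = \<alpha> e] (mod 2 * p) then {(m - offset e) div p} else {})"
    and "odd n \<Longrightarrow> p * n + offset e = m \<Longrightarrow> 0 < n"
proof -
  have pos: "0 < n" if n: "odd n" "p * n + offset e = m" for n
  proof (rule ccontr)
    assume "\<not> 0 < n"
    then have "n \<le> -1" using n(1) by (cases "n = 0") auto
    then have "p * n \<le> p * -1" using p_pos by (intro mult_left_mono) auto
    then show False using n(2) m alpha_bounds(3)[OF e] by (simp add: \<alpha>_def)
  qed
  then show "odd n \<Longrightarrow> p * n + offset e = m \<Longrightarrow> 0 < n" .
  have iff: "(\<exists>n. odd n \<and> p * n + offset e = m) \<longleftrightarrow> [m = \<alpha> e] (mod 2 * p)"
  proof
    assume "\<exists>n. odd n \<and> p * n + offset e = m"
    then obtain k where "p * (2 * k + 1) + offset e = m" by (auto elim: oddE)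
    then have "m - \<alpha> e = (2 * p) * k" by (simp add: \<alpha>_def algebra_simps)
    then show "[m = \<alpha> e] (mod 2 * p)" by (simp add: cong_iff_dvd_diff)
  next
    assume "[m = \<alpha> e] (mod 2 * p)"
    then obtain k where "m - \<alpha> e = (2 * p) * k" unfolding cong_iff_dvd_diff by (elim dvdE)
    then have "p * (2 * k + 1) + offset e = m" by (simp add: \<alpha>_def algebra_simps)
    then show "\<exists>n. odd n \<and> p * n + offset e = m" by (intro exI[of _ "2 * k + 1"]) simp
  qed
  have val: "n = (m - offset e) div p" if "p * n + offset e = m" for n
    using that p_pos by (metis add_diff_cancel_right' less_irrefl nonzero_mult_div_cancel_left)
  show "{n. odd n \<and> p * n + offset e = m}
    = (if [m = \<alpha> e] (mod 2 * p) then {(m - offset e) div p} else {})"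
  proof (cases "[m = \<alpha> e] (mod 2 * p)")
    case True
    then obtain n where n: "odd n" "p * n + offset e = m" using iff by blast
    have "{n. odd n \<and> p * n + offset e = m} = {n}"
      using n val[of n] val by blast
    then show ?thesis using True val[OF n(2)] by simp
  next
    case False
    then show ?thesis using iff by auto
  qed
qed

definition theta_coeff :: "int \<Rightarrow> int" where
  "theta_coeff m = (\<Sum>e\<in>signs. - sign_prod e * of_bool [m = \<alpha> e] (mod 2 * p))"

text \<open>
  The contributions with \<open>p n + offset e = - m\<close> mirror those with \<open>p n + offset e = m\<close> under
  \<open>(e, n) \<mapsto> (- e, - n)\<close>, which flips both \<open>sgn n\<close> and the product of the signs.
\<close>

lemma Zhat_at_square:
  assumes a: "a \<in> spinc_reps G" and m: "0 \<le> m"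
  shows "Zhat G a (xi + of_int (m\<^sup>2) / of_int (4 * p)) = of_int (theta_coeff m)"
proof -
  let ?c = "\<lambda>(e, n). - of_int (sgn n * sign_prod e) / 2 :: complex"
  let ?Q = "\<lambda>m. {(e, n). e \<in> signs \<and> odd n \<and> p * n + offset e = m}"
  have Q: "?Q m = (SIGMA e:signs. {n. odd n \<and> p * n + offset e = m})" for m by auto
  have fin: "finite (?Q m)"
    unfolding Q odd_solution_unique(1)[OF _ m]
    by (intro finite_SigmaI) (auto simp: signs_def odd_solution_unique(1)[OF _ m])
  have "sum ?c (?Q m) = (\<Sum>e\<in>signs. \<Sum>n\<in>{n. odd n \<and> p * n + offset e = m}. ?c (e, n))"
    unfolding Q by (subst sum.Sigma) (auto simp: signs_def odd_solution_unique(1)[OF _ m])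
  also have "\<dots> = (\<Sum>e\<in>signs. of_int (- sign_prod e * of_bool [m = \<alpha> e] (mod 2 * p)) / 2)"
  proof (intro sum.cong refl)
    fix e assume e: "e \<in> signs"
    have "(\<Sum>n\<in>{n. odd n \<and> p * n + offset e = m}. ?c (e, n))
        = (\<Sum>n\<in>{n. odd n \<and> p * n + offset e = m}. - of_int (sign_prod e) / 2)"
      by (intro sum.cong refl) (use odd_solution_unique(2)[OF e m] in auto)
    then show "(\<Sum>n\<in>{n. odd n \<and> p * n + offset e = m}. ?c (e, n))
        = of_int (- sign_prod e * of_bool [m = \<alpha> e] (mod 2 * p)) / 2"
      unfolding odd_solution_unique(1)[OF e m] by simp
  qed
  also have "\<dots> = of_int (theta_coeff m) / 2"
    by (simp add: theta_coeff_def sum_divide_distrib)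
  finally have half: "sum ?c (?Q m) = of_int (theta_coeff m) / 2" .
  let ?neg = "\<lambda>((e1, e2, e3), n). ((- e1, - e2, - e3), - n) :: (int \<times> int \<times> int) \<times> int"
  have neg: "?neg q \<in> ?Q (- m)" if "q \<in> ?Q m" for q m
  proof -
    obtain e1 e2 e3 n where q: "q = ((e1, e2, e3), n)" by (metis prod.exhaust)
    have "offset (- e1, - e2, - e3) = - offset (e1, e2, e3)" by (simp add: offset_def)
    moreover have "(- e1, - e2, - e3) \<in> signs" if "(e1, e2, e3) \<in> signs"
      using that by (auto simp: signs_def)
    ultimately show ?thesis using that by (auto simp: q)
  qed
  have mirror: "sum ?c (?Q (- m)) = sum ?c (?Q m)"
  proof (rule sum.reindex_bij_witness[of _ ?neg ?neg])
    show "?neg q \<in> ?Q (- m)" if "q \<in> ?Q m" for q using neg[OF that] .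
    show "?neg q \<in> ?Q m" if "q \<in> ?Q (- m)" for q using neg[OF that] by simp
  qed (auto simp: sign_prod_def)
  have disj: "?Q m \<inter> ?Q (- m) = {}"
  proof (rule ccontr)
    assume "?Q m \<inter> ?Q (- m) \<noteq> {}"
    then obtain q where q: "q \<in> ?Q m" "q \<in> ?Q (- m)" by blast
    obtain e n where "q = (e, n)" by (cases q)
    with q have en: "e \<in> signs" "odd n" "p * n + offset e = m" "p * n + offset e = - m"
      by simp_all
    then have "p * n + offset e = 0" by simp
    moreover have "0 < n" using odd_solution_unique(2)[OF en(1) m en(2,3)] .
    then have "p * 1 \<le> p * n" using p_pos by (intro mult_left_mono) auto
    ultimately show False using alpha_bounds(2)[OF en(1)] by (simp add: \<alpha>_def)
  qed
  have finneg: "finite (?Q (- m))"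
  proof (rule finite_subset)
    show "?Q (- m) \<subseteq> ?neg ` ?Q m"
    proof
      fix q assume "q \<in> ?Q (- m)"
      from neg[OF this] have "?neg q \<in> ?Q m" by simp
      moreover have "q = ?neg (?neg q)" by (simp split: prod.splits)
      ultimately show "q \<in> ?neg ` ?Q m" by (rule rev_image_eqI)
    qed
  qed (use fin in simp)
  have "{(e, n). e \<in> signs \<and> odd n \<and> xi + of_int ((p * n + offset e)\<^sup>2) / of_int (4 * p)
      = xi + of_int (m\<^sup>2) / of_int (4 * p)} = ?Q m \<union> ?Q (- m)"
  proof -
    have "(xi + of_int (x\<^sup>2) / of_int (4 * p) = xi + of_int (m\<^sup>2) / of_int (4 * p)) \<longleftrightarrow> x = m \<or> x = - m"
      for x :: int
    proof -
      have "(xi + of_int (x\<^sup>2) / of_int (4 * p) = xi + of_int (m\<^sup>2) / of_int (4 * p))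
          \<longleftrightarrow> (of_int (x\<^sup>2) :: rat) = of_int (m\<^sup>2)"
        using p_pos by (simp only: add_left_cancel divide_cancel_right) simp
      also have "\<dots> \<longleftrightarrow> x = m \<or> x = - m"
        by (simp only: of_int_eq_iff power2_eq_iff)
      finally show ?thesis .
    qed
    then show ?thesis by (simp only:) blast
  qed
  then have "Zhat G a (xi + of_int (m\<^sup>2) / of_int (4 * p)) = sum ?c (?Q m \<union> ?Q (- m))"
    by (simp only: Zhat_eq_sum[OF a])
  also have "\<dots> = sum ?c (?Q m) + sum ?c (?Q (- m))"
    by (rule sum.union_disjoint[OF fin finneg disj])
  also have "\<dots> = of_int (theta_coeff m)" unfolding mirror half by simp
  finally show ?thesis .
qed

lemma Zhat_at_nonsquare:
  assumes a: "a \<in> spinc_reps G" and r: "\<And>m::nat. r - xi \<noteq> of_nat (m\<^sup>2) / of_int (4 * p)"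
  shows "Zhat G a r = 0"
proof -
  have "xi + of_int (x\<^sup>2) / of_int (4 * p) \<noteq> r" for x :: int
  proof
    assume "xi + of_int (x\<^sup>2) / of_int (4 * p) = r"
    moreover have "(of_nat ((nat \<bar>x\<bar>)\<^sup>2) :: rat) = of_int (x\<^sup>2)"
      by (metis int_nat_eq abs_ge_zero of_int_of_nat_eq of_nat_power power2_abs)
    ultimately show False using r[of "nat \<bar>x\<bar>"] by auto
  qed
  then show ?thesis by (simp only: Zhat_eq_sum[OF a]) simp
qed

text \<open>
  The four sign vectors that begin with \<open>1\<close> give the negative halves of the false theta functions,
  since \<open>\<alpha> (- e) \<equiv> - \<alpha> e\<close> modulo \<open>2 p\<close>.
\<close>

lemma theta_coeff_eq:
  "theta_coeff (int m) = false_theta_coeff p (\<alpha> (-1, -1, -1)) m - false_theta_coeff p (\<alpha> (-1, -1, 1)) m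
     - false_theta_coeff p (\<alpha> (-1, 1, -1)) m + false_theta_coeff p (\<alpha> (-1, 1, 1)) m"
proof -
  have mirror: "[int m = - \<alpha> (-1, e2, e3)] (mod 2 * p) \<longleftrightarrow> [int m = \<alpha> (1, - e2, - e3)] (mod 2 * p)"
    for e2 e3
  proof -
    have "\<alpha> (1, - e2, - e3) = - \<alpha> (-1, e2, e3) + 2 * p"
      by (simp add: \<alpha>_def offset_def)
    then show ?thesis by (simp add: cong_def)
  qed
  have signs: "(-1, e2, e3) \<in> signs" if "e2 \<in> {-1, 1}" "e3 \<in> {-1, 1}" for e2 e3
    unfolding signs_def using that by blast
  have eq: "false_theta_coeff p (\<alpha> (-1, e2, e3)) m = of_bool [int m = \<alpha> (-1, e2, e3)] (mod 2 * p)
      - of_bool [int m = \<alpha> (1, - e2, - e3)] (mod 2 * p)"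
    if "e2 \<in> {-1, 1}" "e3 \<in> {-1, 1}" for e2 e3
    using false_theta_coeff_eq[OF not_p_dvd_alpha[OF signs[OF that]]] by (simp only: mirror)
  have set: "signs = {(-1,-1,-1), (-1,-1,1), (-1,1,-1), (-1,1,1), (1,-1,-1), (1,-1,1), (1,1,-1), (1,1,1)}"
    by (auto simp: signs_def)
  show ?thesis
    unfolding theta_coeff_def set
    by (simp add: eq sign_prod_def)
qed

lemma Zhat_eq_false_theta:
  assumes a: "a \<in> spinc_reps G"
  shows "Zhat G a r = false_theta p (\<alpha> (-1, -1, -1)) (r - xi) - false_theta p (\<alpha> (-1, -1, 1)) (r - xi)
     - false_theta p (\<alpha> (-1, 1, -1)) (r - xi) + false_theta p (\<alpha> (-1, 1, 1)) (r - xi)"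
proof (cases "\<exists>m::nat. r - xi = of_nat (m\<^sup>2) / of_int (4 * p)")
  case True
  then obtain m :: nat where m: "r - xi = of_nat (m\<^sup>2) / of_int (4 * p)" by blast
  then have "r = xi + of_int ((int m)\<^sup>2) / of_int (4 * p)" by simp
  then have "Zhat G a r = of_int (theta_coeff (int m))"
    using Zhat_at_square[OF a, of "int m"] by simp
  then show ?thesis
    unfolding m false_theta_square[OF p_pos] theta_coeff_eq by simp
next
  case False
  then show ?thesis using Zhat_at_nonsquare[OF a] false_theta_nonsquare[of "r - xi" p] by simp
qed

text \<open>
  For \<open>0 \<le> m < 2 p\<close> the congruence \<open>m \<equiv> \<alpha> e\<close> is an equality, so the least \<open>m\<close> with a nonzero
  coefficient is the smallest of the \<open>\<alpha> e\<close>.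
\<close>

lemma theta_coeff_lowest:
  assumes "0 \<le> m" "m \<le> \<alpha> (-1, -1, -1)"
  shows "theta_coeff m = of_bool (m = \<alpha> (-1, -1, -1))"
proof -
  let ?e0 = "(-1, -1, -1) :: int \<times> int \<times> int"
  have e0: "?e0 \<in> signs" by (simp add: signs_def)
  have eq: "[m = \<alpha> e] (mod 2 * p) \<longleftrightarrow> m = \<alpha> ?e0 \<and> e = ?e0" if "e \<in> signs" for e
  proof -
    have "m < 2 * p" using assms alpha_bounds(3)[OF e0] by linarith
    then have "[m = \<alpha> e] (mod 2 * p) \<longleftrightarrow> m = \<alpha> e"
      using assms(1) alpha_bounds(2,3)[OF that] by (simp add: cong_def)
    then show ?thesis using alpha_bounds(1,4)[OF that] assms(2) by auto
  qed
  have "theta_coeff m = (\<Sum>e\<in>signs. if e = ?e0 then of_bool (m = \<alpha> ?e0) else 0)"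
    unfolding theta_coeff_def by (intro sum.cong refl) (auto simp: eq sign_prod_def)
  also have "\<dots> = of_bool (m = \<alpha> ?e0)"
    using e0 by (subst sum.delta) (auto simp: signs_def)
  finally show ?thesis .
qed

lemma Delta_eq:
  assumes a: "a \<in> spinc_reps G"
  shows "Delta G a = xi + of_int ((\<alpha> (-1, -1, -1))\<^sup>2) / of_int (4 * p)"
proof (rule Delta_eqI)
  let ?a = "\<alpha> (-1, -1, -1)"
  have pos: "0 < ?a" by (rule alpha_bounds(2)) (simp add: signs_def)
  show "Zhat G a (xi + of_int (?a\<^sup>2) / of_int (4 * p)) \<noteq> 0"
    using Zhat_at_square[OF a, of ?a] theta_coeff_lowest[of ?a] pos by simp
  fix r
  have cases: "Zhat G a r = 0 \<or> (\<exists>m\<ge>0. r = xi + of_int (m\<^sup>2) / of_int (4 * p))"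
  proof (cases "\<exists>m::nat. r - xi = of_nat (m\<^sup>2) / of_int (4 * p)")
    case True
    then obtain m :: nat where "r - xi = of_nat (m\<^sup>2) / of_int (4 * p)" by blast
    then have "r = xi + of_int ((int m)\<^sup>2) / of_int (4 * p)" by simp
    then show ?thesis by (intro disjI2 exI[of _ "int m"]) simp
  next
    case False
    then show ?thesis using Zhat_at_nonsquare[OF a] by blast
  qed
  show "Zhat G a r \<in> \<rat>"
    using cases Zhat_at_square[OF a] by auto
  assume r: "r < xi + of_int (?a\<^sup>2) / of_int (4 * p)"
  show "Zhat G a r = 0"
    using cases
  proof
    assume "\<exists>m\<ge>0. r = xi + of_int (m\<^sup>2) / of_int (4 * p)"
    then obtain m where m: "0 \<le> m" "r = xi + of_int (m\<^sup>2) / of_int (4 * p)" by blast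
    have "(of_int (m\<^sup>2) :: rat) < of_int (?a\<^sup>2)"
      using r p_pos unfolding m(2) add_less_cancel_left by (simp only: divide_less_cancel)
    then have "m\<^sup>2 < ?a\<^sup>2" by (simp only: of_int_less_iff)
    then have "m < ?a" using pos by (simp add: power_less_imp_less_base)
    then show ?thesis
      using Zhat_at_square[OF a m(1)] theta_coeff_lowest[OF m(1)] m(2) by simp
  qed
qed

end

theorem proposition3p3:
  fixes b1 b2 b3 b a1 a2 a3 p \<alpha>1 \<alpha>2 \<alpha>3 \<alpha>4 :: int
    and k1 k2 k3 :: "int list"
    and G :: plumbing
    and s :: nat
    and M :: "int Matrix.mat"
    and h1 h2 h3 :: int
    and \<xi> :: rat
    and a :: "int Matrix.vec"
  assumes "1 < b1" "b1 < b2" "b2 < b3"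
    and "coprime b1 b2" "coprime b1 b3" "coprime b2 b3"
    and "(b1, b2, b3) \<noteq> (2, 3, 5)"
    and "b < 0" "0 < a1" "0 < a2" "0 < a3"
    and "b1 * b2 * b3 * b + b2 * b3 * a1 + b1 * b3 * a2 + b1 * b2 * a3 = -1"
    and "cfrac_of k1 (of_int b1 / of_int a1)"
    and "cfrac_of k2 (of_int b2 / of_int a2)"
    and "cfrac_of k3 (of_int b3 / of_int a3)"
  defines "G \<equiv> three_leg_tree b k1 k2 k3"
    and "s \<equiv> nverts G"
    and "M \<equiv> linking_matrix G"
    and "p \<equiv> b1 * b2 * b3"
    and "\<alpha>1 \<equiv> p - b1 * b2 - b1 * b3 - b2 * b3"
    and "\<alpha>2 \<equiv> p + b1 * b2 - b1 * b3 - b2 * b3"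
    and "\<alpha>3 \<equiv> p - b1 * b2 + b1 * b3 - b2 * b3"
    and "\<alpha>4 \<equiv> p + b1 * b2 + b1 * b3 - b2 * b3"
    and "h1 \<equiv> \<bar>Determinant.det (linking_matrix (del_vertex (length k1) G))\<bar>"
    and "h2 \<equiv> \<bar>Determinant.det (linking_matrix (del_vertex (length k1 + length k2) G))\<bar>"
    and "h3 \<equiv> \<bar>Determinant.det
                  (linking_matrix (del_vertex (length k1 + length k2 + length k3) G))\<bar>"
    and "\<xi> \<equiv> 1 / 4 * (of_int (h1 + h2 + h3) - 3 * of_nat s - of_int (mat_trace M)
                 - of_int (b2 * b3) / of_int b1
                 - of_int (b1 * b3) / of_int b2
                 - of_int (b1 * b2) / of_int b3)"
  assumes "a \<in> spinc_reps G"
  shows "Zhat G a = qshift (Delta G a) (qshift (- (of_int (\<alpha>1\<^sup>2) / of_int (4 * p)))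
           (\<lambda>r. false_theta p \<alpha>1 r - false_theta p \<alpha>2 r
                - false_theta p \<alpha>3 r + false_theta p \<alpha>4 r))
         \<and> Delta G a = \<xi> + of_int (\<alpha>1\<^sup>2) / of_int (4 * p)"
proof -
  interpret T: brieskorn_sphere_tree b1 b2 b3 b a1 a2 a3 k1 k2 k3
  proof unfold_locales
    show "b1 * b2 + b1 * b3 + b2 * b3 < b1 * b2 * b3"
      by (rule sum_pair_products_less_product) (use assms in auto)
  qed (use assms in auto)
  have G: "T.G = G" and p: "T.p = p" by (simp_all add: T.G_def G_def T.p_def p_def)
  have xi: "T.xi = \<xi>"
    by (simp only: T.xi_def T.h_def T.t1_def T.t2_def T.t3_def T.s_def T.M_def G \<xi>_def h1_def h2_def
        h3_def s_def M_def)
  have alpha: "T.\<alpha> (-1, -1, -1) = \<alpha>1" "T.\<alpha> (-1, -1, 1) = \<alpha>2" "T.\<alpha> (-1, 1, -1) = \<alpha>3"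
    "T.\<alpha> (-1, 1, 1) = \<alpha>4"
    by (simp_all add: T.\<alpha>_def T.offset_def p \<alpha>1_def \<alpha>2_def \<alpha>3_def \<alpha>4_def)
  have a: "a \<in> spinc_reps T.G" using assms by (simp add: G)
  have Delta: "Delta G a = \<xi> + of_int (\<alpha>1\<^sup>2) / of_int (4 * p)"
    using T.Delta_eq[OF a] by (simp only: G p xi alpha)
  have Zhat: "Zhat G a r = false_theta p \<alpha>1 (r - \<xi>) - false_theta p \<alpha>2 (r - \<xi>)
      - false_theta p \<alpha>3 (r - \<xi>) + false_theta p \<alpha>4 (r - \<xi>)" for r
    using T.Zhat_eq_false_theta[OF a, of r] by (simp only: G p xi alpha)
  have "Zhat G a = qshift (Delta G a) (qshift (- (of_int (\<alpha>1\<^sup>2) / of_int (4 * p)))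
      (\<lambda>r. false_theta p \<alpha>1 r - false_theta p \<alpha>2 r - false_theta p \<alpha>3 r + false_theta p \<alpha>4 r))"
  proof
    fix r :: rat
    have shift: "r - (\<xi> + x) - - x = r - \<xi>" for x by simp
    show "Zhat G a r = qshift (Delta G a) (qshift (- (of_int (\<alpha>1\<^sup>2) / of_int (4 * p)))
      (\<lambda>r. false_theta p \<alpha>1 r - false_theta p \<alpha>2 r - false_theta p \<alpha>3 r + false_theta p \<alpha>4 r)) r"
      unfolding qshift_def Delta shift by (rule Zhat)
  qed
  with Delta show ?thesis by blast
qed

end
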